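(* Let $\alpha>0$. A discrete set $\Gamma\subset\mathbb{C}$ is a set of sampling for $F_\alpha^\infty$ if and only if $\Gamma$ contains a uniformly discrete subset $\Gamma'$ for which $D^-(\Gamma')>\alpha/\pi$.
   Context: For $\alpha>0$, $F_\alpha^\infty$ is the Banach space of entire functions $f$ with $\|f\|_\infty=\sup_{z\in\mathbb{C}}e^{-\alpha|z|^2/2}|f(z)|<\infty$. A discrete set $\Gamma\subset\mathbb{C}$ is a set of sampling for $F_\alpha^\infty$ if there exists a positive number $K$ such that $\|f\|_\infty\le K\sup_{z\in\Gamma}e^{-\alpha|z|^2/2}|f(z)|$ for all $f\in F_\alpha^\infty$. A set $\Gamma=\{z_j\}\subset\mathbb{C}$ (distinct points) is uniformly discrete if $q=\inf_{j\ne k}|z_j-z_k|>0$. Lower uniform density: fix a compact set $I\subset\mathbb{C}$ of (Lebesgue) measure $1$ whose boundary has measure $0$. For a uniformly discrete set $\Gamma$ and $r>0$, let $n^-(r)$ be the smallest number of points of $\Gamma$ to be found in a translate of $rI$. Then $D^-(\Gamma)=\liminf_{r\to\infty} n^-(r)/r^2$. (This value is independent of the choice of $I$, by a result of Landau.) *)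

theory Defs
  imports "HOL-Analysis.Analysis"
begin

text \<open>The weighted supremum of \<open>f\<close> over a set \<open>S\<close>. It is valued in \<^typ>\<open>ennreal\<close>, so that
  an unbounded family has supremum \<open>\<infinity>\<close> and the empty family has supremum \<open>0\<close>.\<close>

definition fock_sup :: "real \<Rightarrow> complex set \<Rightarrow> (complex \<Rightarrow> complex) \<Rightarrow> ennreal" where
  "fock_sup \<alpha> S f = (SUP z\<in>S. ennreal (exp (- \<alpha> * (cmod z)\<^sup>2 / 2) * cmod (f z)))"

definition fock_norm :: "real \<Rightarrow> (complex \<Rightarrow> complex) \<Rightarrow> ennreal" where
  "fock_norm \<alpha> f = fock_sup \<alpha> UNIV f"

definition fock_space :: "real \<Rightarrow> (complex \<Rightarrow> complex) set" where
  "fock_space \<alpha> = {f. f holomorphic_on UNIV \<and> fock_norm \<alpha> f < \<infinity>}"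

definition set_of_sampling :: "real \<Rightarrow> complex set \<Rightarrow> bool" where
  "set_of_sampling \<alpha> \<Gamma> \<longleftrightarrow>
     (\<exists>K::real. K > 0 \<and> (\<forall>f\<in>fock_space \<alpha>. fock_norm \<alpha> f \<le> ennreal K * fock_sup \<alpha> \<Gamma> f))"

text \<open>The smallest number of points of \<open>\<Gamma>\<close> in a translate \<open>w + r I\<close>. The cardinality is only
  meaningful when these intersections are finite, which holds for compact \<open>I\<close> and uniformly
  discrete \<open>\<Gamma>\<close>; the infimum is over a nonempty set of natural numbers, hence attained.\<close>

definition n_minus :: "complex set \<Rightarrow> complex set \<Rightarrow> real \<Rightarrow> nat" where
  "n_minus I \<Gamma> r = (INF w. card (\<Gamma> \<inter> (\<lambda>z. w + r *\<^sub>R z) ` I))"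

definition lower_density :: "complex set \<Rightarrow> complex set \<Rightarrow> ereal" where
  "lower_density I \<Gamma> = Liminf at_top (\<lambda>r::real. ereal (real (n_minus I \<Gamma> r) / r\<^sup>2))"

end

theory Submission
  imports Defs "HOL-Complex_Analysis.Conformal_Mappings"
begin

text \<open>
  The proof is quantitative throughout: it uses neither weak limits of translates of \<open>\<Gamma>\<close> nor duality.
  All statements are invariant under the Weyl translations \<open>fock_shift\<close>, so estimates are made at the
  origin. Every error of the size of half the norm is absorbed by \<open>samples_by_contraction\<close>.

  Density implies sampling. A function \<open>f\<close> of the space grows at most like \<open>exp (\<alpha> * R\<^sup>2 / 2)\<close> on circles,
  whereas by Jensen's inequality at least \<open>\<beta> * t\<^sup>2\<close> zeros in every disc of large radius \<open>t\<close> force a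
  decrease by \<open>exp (- \<beta> * R\<^sup>2 / 2)\<close>, up to a constant, at the centre. For \<open>\<beta> > \<alpha>\<close> the zeros win, so a
  function vanishing on \<open>\<Gamma>\<close> vanishes identically. A function that is merely small on \<open>\<Gamma>\<close> is
  treated by subtracting the Lagrange polynomial of its values in one large disc, which is harmless because the points are separated
  (\<open>sampling_of_card_cball\<close>).

  Sampling implies density. The Bernstein inequality (\<open>bernstein\<close>) shows that a maximal separated
  subset of a set of sampling is still one (\<open>samples_uniform_discrete_subset\<close>). A polynomial of degree
  at most \<open>\<beta> * \<rho>\<^sup>2\<close> has weighted modulus concentrated in the disc of radius \<open>\<rho>\<close>; applied to the polynomial
  that vanishes at the points of a disc, this yields at least \<open>\<beta> * (R - c)\<^sup>2\<close> points in every disc of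
  radius \<open>R\<close> (\<open>samples_card_cball\<close>), hence density at least \<open>\<beta> / pi\<close>. The strict inequality comes from the
  fact that sampling for the exponent \<open>\<alpha>\<close> persists for some \<open>\<beta> > \<alpha>\<close> (\<open>samples_larger_exponent\<close>), which is
  the heart of the matter and is proved by averaging dilates of a function, so chosen that their
  errors sit in disjoint annuli.

  Discs and dilates of \<open>I\<close> are exchanged by averaging point counts over translates (\<open>average_count\<close>).
\<close>

section \<open>Weighted modulus and sampling constants\<close>

definition wmod :: "real \<Rightarrow> (complex \<Rightarrow> complex) \<Rightarrow> complex \<Rightarrow> real" where
  "wmod \<alpha> f z = exp (- \<alpha> * (cmod z)\<^sup>2 / 2) * cmod (f z)"

text \<open>The sampling inequality with constant \<open>K\<close>, in real-valued form: the unknown bound \<open>M\<close>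
  says that \<open>f\<close> lies in the space, and \<open>s\<close> stands for the supremum over \<open>\<Gamma>\<close>. The clause \<open>0 \<le> s\<close>
  matches the convention that the empty family has supremum \<open>0\<close>.\<close>

definition samples :: "real \<Rightarrow> real \<Rightarrow> complex set \<Rightarrow> bool" where
  "samples \<alpha> K \<Gamma> \<longleftrightarrow> (\<forall>f M s. f holomorphic_on UNIV \<longrightarrow> (\<forall>z. wmod \<alpha> f z \<le> M) \<longrightarrow>
     0 \<le> s \<longrightarrow> (\<forall>z\<in>\<Gamma>. wmod \<alpha> f z \<le> s) \<longrightarrow> (\<forall>z. wmod \<alpha> f z \<le> K * s))"

lemma wmod_nonneg [simp]: "0 \<le> wmod \<alpha> f z"
  by (simp add: wmod_def)

lemma wmod_zero [simp]: "wmod \<alpha> f 0 = cmod (f 0)"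
  by (simp add: wmod_def)

lemma cmod_eq_wmod: "cmod (f z) = exp (\<alpha> * (cmod z)\<^sup>2 / 2) * wmod \<alpha> f z"
  by (simp add: wmod_def mult.assoc[symmetric] exp_add[symmetric])

lemma samplesD:
  assumes "samples \<alpha> K \<Gamma>" "f holomorphic_on UNIV" "\<And>z. wmod \<alpha> f z \<le> M"
    and "0 \<le> s" "\<And>z. z \<in> \<Gamma> \<Longrightarrow> wmod \<alpha> f z \<le> s"
  shows "wmod \<alpha> f z \<le> K * s"
  using assms unfolding samples_def by blast

lemma samples_mono:
  assumes "samples \<alpha> K \<Gamma>" "\<Gamma> \<subseteq> \<Delta>"
  shows "samples \<alpha> K \<Delta>"
  using assms unfolding samples_def by blast

lemma fock_space_iff:
  "f \<in> fock_space \<alpha> \<longleftrightarrow> f holomorphic_on UNIV \<and> (\<exists>M. \<forall>z. wmod \<alpha> f z \<le> M)"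
proof -
  have "fock_norm \<alpha> f < \<infinity> \<longleftrightarrow> (\<exists>M. \<forall>z. wmod \<alpha> f z \<le> M)"
  proof
    assume fin: "fock_norm \<alpha> f < \<infinity>"
    have "wmod \<alpha> f z \<le> enn2real (fock_norm \<alpha> f)" for z
    proof -
      have "ennreal (wmod \<alpha> f z) \<le> fock_norm \<alpha> f"
        unfolding fock_norm_def fock_sup_def wmod_def by (rule SUP_upper) simp
      then show ?thesis
        using fin by (metis enn2real_leI enn2real_mono enn2real_ennreal wmod_nonneg infinity_ennreal_def)
    qed
    then show "\<exists>M. \<forall>z. wmod \<alpha> f z \<le> M" by blast
  next
    assume "\<exists>M. \<forall>z. wmod \<alpha> f z \<le> M"
    then obtain M where M: "\<And>z. wmod \<alpha> f z \<le> M" by blast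
    have "fock_norm \<alpha> f \<le> ennreal M"
      unfolding fock_norm_def fock_sup_def
      by (rule SUP_least) (use M in \<open>auto intro!: ennreal_leI simp: wmod_def\<close>)
    then show "fock_norm \<alpha> f < \<infinity>"
      using ennreal_less_top by (metis infinity_ennreal_def order_le_less_trans)
  qed
  then show ?thesis by (simp add: fock_space_def)
qed

lemma set_of_sampling_iff: "set_of_sampling \<alpha> \<Gamma> \<longleftrightarrow> (\<exists>K>0. samples \<alpha> K \<Gamma>)"
proof
  assume "set_of_sampling \<alpha> \<Gamma>"
  then obtain K where K: "K > 0"
    "\<And>f. f \<in> fock_space \<alpha> \<Longrightarrow> fock_norm \<alpha> f \<le> ennreal K * fock_sup \<alpha> \<Gamma> f"
    by (auto simp: set_of_sampling_def)
  have "samples \<alpha> K \<Gamma>"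
    unfolding samples_def
  proof (intro allI impI)
    fix f M s z
    assume f: "f holomorphic_on UNIV" "\<forall>z. wmod \<alpha> f z \<le> M" and s: "0 \<le> s" "\<forall>z\<in>\<Gamma>. wmod \<alpha> f z \<le> s"
    have "ennreal (wmod \<alpha> f z) \<le> fock_norm \<alpha> f"
      unfolding fock_norm_def fock_sup_def wmod_def by (rule SUP_upper) simp
    also have "\<dots> \<le> ennreal K * fock_sup \<alpha> \<Gamma> f"
      using f by (intro K(2)) (auto simp: fock_space_iff)
    also have "fock_sup \<alpha> \<Gamma> f \<le> ennreal s"
      unfolding fock_sup_def
      by (rule SUP_least) (use s in \<open>auto intro!: ennreal_leI simp: wmod_def\<close>)
    then have "ennreal K * fock_sup \<alpha> \<Gamma> f \<le> ennreal (K * s)"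
      using K(1) s(1) by (simp add: ennreal_mult mult_left_mono)
    finally show "wmod \<alpha> f z \<le> K * s"
      using K(1) s(1) by (simp add: ennreal_le_iff)
  qed
  then show "\<exists>K>0. samples \<alpha> K \<Gamma>" using K(1) by blast
next
  assume "\<exists>K>0. samples \<alpha> K \<Gamma>"
  then obtain K where K: "K > 0" "samples \<alpha> K \<Gamma>" by blast
  have "fock_norm \<alpha> f \<le> ennreal K * fock_sup \<alpha> \<Gamma> f" if f: "f \<in> fock_space \<alpha>" for f
  proof -
    obtain M where hol: "f holomorphic_on UNIV" and M: "\<And>z. wmod \<alpha> f z \<le> M"
      using f by (auto simp: fock_space_iff)
    define s where "s = enn2real (fock_sup \<alpha> \<Gamma> f)"
    have s0: "0 \<le> s" by (simp add: s_def)
    have "fock_sup \<alpha> \<Gamma> f \<le> ennreal M"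
      unfolding fock_sup_def
      by (rule SUP_least) (use M in \<open>auto intro!: ennreal_leI simp: wmod_def\<close>)
    then have sup: "fock_sup \<alpha> \<Gamma> f = ennreal s"
      unfolding s_def by (intro ennreal_enn2real[symmetric] le_less_trans[OF _ ennreal_less_top])
    have "wmod \<alpha> f z \<le> s" if "z \<in> \<Gamma>" for z
    proof -
      have "ennreal (wmod \<alpha> f z) \<le> ennreal s"
        unfolding sup[symmetric] fock_sup_def wmod_def by (rule SUP_upper) fact
      then show ?thesis using s0 by (simp add: ennreal_le_iff)
    qed
    then have "wmod \<alpha> f z \<le> K * s" for z
      using samplesD[OF K(2) hol M s0, of z] by blast
    then have "fock_norm \<alpha> f \<le> ennreal (K * s)"
      unfolding fock_norm_def fock_sup_def
      by (intro SUP_least) (auto intro!: ennreal_leI simp: wmod_def)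
    then show ?thesis using K(1) s0 by (simp add: sup ennreal_mult)
  qed
  then show "set_of_sampling \<alpha> \<Gamma>" using K(1) by (auto simp: set_of_sampling_def)
qed

text \<open>Since \<open>M\<close> may be taken to be the norm of \<open>f\<close>, a loss of \<open>M / 2\<close> can be absorbed into the left-hand
  side. All the approximate sampling inequalities below are turned into exact ones in this way, so
  that no point where the norm is nearly attained has to be chosen.\<close>

lemma samples_by_contraction:
  assumes "K > 0"
    and step: "\<And>f M s z. \<lbrakk>f holomorphic_on UNIV; \<And>z. wmod \<alpha> f z \<le> M; 0 \<le> s;
      \<And>z. z \<in> \<Gamma> \<Longrightarrow> wmod \<alpha> f z \<le> s\<rbrakk> \<Longrightarrow> wmod \<alpha> f z \<le> K * s + M / 2"
  shows "samples \<alpha> (2 * K) \<Gamma>"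
  unfolding samples_def
proof (intro allI impI)
  fix f M s z
  assume f: "f holomorphic_on UNIV" "\<forall>z. wmod \<alpha> f z \<le> M" and s: "0 \<le> s" "\<forall>z\<in>\<Gamma>. wmod \<alpha> f z \<le> s"
  define N where "N = (SUP z. wmod \<alpha> f z)"
  have N: "wmod \<alpha> f z \<le> N" for z
    unfolding N_def by (rule cSUP_upper) (use f(2) in \<open>auto simp: bdd_above_def\<close>)
  have "wmod \<alpha> f z \<le> K * s + N / 2" for z
    using s(2) by (intro step[OF f(1) N s(1)]) blast
  then have "N \<le> K * s + N / 2"
    unfolding N_def by (intro cSUP_least) auto
  then show "wmod \<alpha> f z \<le> 2 * K * s" using N[of z] by simp
qed

section \<open>Translations and the Bernstein inequality\<close>

text \<open>The Weyl translation: the exponential factor makes it act on weighted moduli as the plain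
  translation by \<open>w\<close>, so every estimate may be proved at the origin only.\<close>

definition fock_shift :: "real \<Rightarrow> complex \<Rightarrow> (complex \<Rightarrow> complex) \<Rightarrow> complex \<Rightarrow> complex" where
  "fock_shift \<alpha> w f z =
     exp (- of_real \<alpha> * cnj w * z - of_real (\<alpha> * (cmod w)\<^sup>2 / 2)) * f (z + w)"

lemma wmod_fock_shift: "wmod \<alpha> (fock_shift \<alpha> w f) z = wmod \<alpha> f (z + w)"
proof -
  have *: "(cmod (z + w))\<^sup>2 = (cmod z)\<^sup>2 + 2 * Re (cnj w * z) + (cmod w)\<^sup>2"
    by (simp only: cmod_power2) (simp add: power2_eq_square algebra_simps)
  have "- \<alpha> * (cmod z)\<^sup>2 / 2 + Re (- of_real \<alpha> * cnj w * z - of_real (\<alpha> * (cmod w)\<^sup>2 / 2))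
      = - \<alpha> * (cmod (z + w))\<^sup>2 / 2"
    unfolding * by (simp add: algebra_simps add_divide_distrib)
  then show ?thesis
    unfolding wmod_def fock_shift_def norm_mult norm_exp_eq_Re mult.assoc[symmetric]
      exp_add[symmetric] by (rule arg_cong)
qed

lemma holomorphic_fock_shift:
  assumes "f holomorphic_on UNIV"
  shows "fock_shift \<alpha> w f holomorphic_on UNIV"
proof -
  have "(f \<circ> (\<lambda>z. z + w)) holomorphic_on UNIV"
    by (rule holomorphic_on_compose) (auto intro!: holomorphic_intros holomorphic_on_subset[OF assms])
  then show ?thesis
    unfolding fock_shift_def[abs_def] by (auto intro!: holomorphic_intros simp: o_def)
qed

lemma samples_translate:
  assumes "samples \<alpha> K \<Gamma>"
  shows "samples \<alpha> K {z. z + w \<in> \<Gamma>}"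
  unfolding samples_def
proof (intro allI impI)
  fix f M s z
  assume f: "f holomorphic_on UNIV" "\<forall>z. wmod \<alpha> f z \<le> M"
    and s: "0 \<le> s" "\<forall>z\<in>{z. z + w \<in> \<Gamma>}. wmod \<alpha> f z \<le> s"
  have "wmod \<alpha> (fock_shift \<alpha> (-w) f) (z + w) \<le> K * s"
    by (rule samplesD[OF assms holomorphic_fock_shift[OF f(1)]])
       (use f s in \<open>auto simp: wmod_fock_shift\<close>)
  then show "wmod \<alpha> f z \<le> K * s" by (simp add: wmod_fock_shift)
qed

text \<open>A Lipschitz constant for weighted moduli of functions of norm \<open>1\<close>. Its size is immaterial; that
  it increases with \<open>\<alpha>\<close> permits one constant for all exponents in a bounded range.\<close>

definition bernstein_const :: "real \<Rightarrow> real" where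
  "bernstein_const \<alpha> = (1 + \<alpha>) * exp (2 * \<alpha>)"

lemma bernstein_const_ge_1: "0 < \<alpha> \<Longrightarrow> 1 \<le> bernstein_const \<alpha>"
  unfolding bernstein_const_def using mult_mono[of 1 "1 + \<alpha>" 1 "exp (2 * \<alpha>)"] by simp

lemma bernstein_const_mono: "0 < \<alpha> \<Longrightarrow> \<alpha> \<le> \<beta> \<Longrightarrow> bernstein_const \<alpha> \<le> bernstein_const \<beta>"
  unfolding bernstein_const_def by (intro mult_mono) auto

text \<open>Near the origin the weight is comparable to \<open>1\<close>, so \<open>f\<close> is bounded on the disc of radius \<open>2\<close> and the
  Cauchy inequality controls \<open>f'\<close> on the unit disc; the weight itself differs from \<open>1\<close> by
  at most \<open>\<alpha> * cmod u\<close>.\<close>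

lemma bernstein_at_zero:
  assumes f: "f holomorphic_on UNIV" and M: "\<And>z. wmod \<alpha> f z \<le> M" and "0 < \<alpha>" and u: "cmod u \<le> 1"
  shows "\<bar>wmod \<alpha> f u - wmod \<alpha> f 0\<bar> \<le> bernstein_const \<alpha> * M * cmod u"
proof -
  have M0: "0 \<le> M" using M[of 0] wmod_nonneg order_trans by blast
  have bound: "cmod (f z) \<le> exp (\<alpha> * r\<^sup>2 / 2) * M" if "cmod z \<le> r" for z r
  proof -
    have "(cmod z)\<^sup>2 \<le> r\<^sup>2" using that by (intro power_mono) auto
    then show ?thesis
      using M[of z] \<open>0 < \<alpha>\<close> M0 by (subst cmod_eq_wmod[of _ _ \<alpha>]) (intro mult_mono, auto)
  qed
  have fd: "f field_differentiable (at z within S)" for z S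
    using f by (metis UNIV_I field_differentiable_at_within holomorphic_on_def)
  have deriv_bound: "cmod (deriv f z) \<le> exp (2 * \<alpha>) * M" if "z \<in> cball 0 1" for z
  proof -
    have "cmod ((deriv ^^ 1) f z) \<le> fact 1 * (exp (2 * \<alpha>) * M) / 1 ^ 1"
    proof (rule Cauchy_inequality)
      show "cmod (f x) \<le> exp (2 * \<alpha>) * M" if "cmod (z - x) = 1" for x
      proof -
        have "cmod x \<le> 2"
          using norm_triangle_ineq4[of z "z - x"] that \<open>z \<in> cball 0 1\<close> by simp
        then show ?thesis using bound[of x 2] by (simp add: mult.commute)
      qed
    qed (use f in \<open>auto intro: holomorphic_on_subset holomorphic_on_imp_continuous_on\<close>)
    then show ?thesis by simp
  qed
  have 1: "cmod (f u - f 0) \<le> exp (2 * \<alpha>) * M * cmod u"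
  proof -
    have "cmod (f u - f 0) \<le> exp (2 * \<alpha>) * M * cmod (u - 0)"
    proof (rule field_differentiable_bound[where S = "cball 0 1"])
      show "(f has_field_derivative deriv f z) (at z within cball 0 1)" for z
        using fd[of z UNIV] DERIV_deriv_iff_field_differentiable
        by (metis has_field_derivative_at_within)
    qed (use u deriv_bound in auto)
    then show ?thesis by simp
  qed
  define x where "x = \<alpha> * (cmod u)\<^sup>2 / 2"
  have x: "0 \<le> x" "x \<le> \<alpha> * cmod u"
    using \<open>0 < \<alpha>\<close> u mult_mono[of "cmod u" 1 "cmod u" "2 * cmod u"]
    by (auto simp: x_def power2_eq_square)
  have ex: "0 \<le> 1 - exp (- x)" "1 - exp (- x) \<le> x"
    using x(1) exp_ge_add_one_self[of "-x"] by auto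
  have fu: "cmod (f u) \<le> exp (2 * \<alpha>) * M"
    using bound[of u 2] u by (simp add: mult.commute)
  have 2: "\<bar>wmod \<alpha> f u - cmod (f u)\<bar> \<le> \<alpha> * cmod u * (exp (2 * \<alpha>) * M)"
  proof -
    have "wmod \<alpha> f u - cmod (f u) = - ((1 - exp (- x)) * cmod (f u))"
      by (simp add: wmod_def x_def algebra_simps)
    then have "\<bar>wmod \<alpha> f u - cmod (f u)\<bar> = (1 - exp (- x)) * cmod (f u)"
      using ex(1) by (simp add: abs_mult)
    also have "\<dots> \<le> \<alpha> * cmod u * (exp (2 * \<alpha>) * M)"
      using ex x fu by (intro mult_mono) auto
    finally show ?thesis .
  qed
  have 3: "\<bar>cmod (f u) - cmod (f 0)\<bar> \<le> cmod (f u - f 0)"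
    by (rule norm_triangle_ineq3)
  have "\<bar>wmod \<alpha> f u - wmod \<alpha> f 0\<bar> \<le> \<alpha> * cmod u * (exp (2 * \<alpha>) * M) + exp (2 * \<alpha>) * M * cmod u"
    using 1 2 3 unfolding wmod_zero by linarith
  then show ?thesis by (simp add: bernstein_const_def algebra_simps)
qed

lemma bernstein:
  assumes f: "f holomorphic_on UNIV" and M: "\<And>z. wmod \<alpha> f z \<le> M" and "0 < \<alpha>"
  shows "\<bar>wmod \<alpha> f z - wmod \<alpha> f w\<bar> \<le> bernstein_const \<alpha> * M * dist z w"
proof (cases "dist z w \<le> 1")
  case True
  have "\<bar>wmod \<alpha> (fock_shift \<alpha> w f) (z - w) - wmod \<alpha> (fock_shift \<alpha> w f) 0\<bar>
      \<le> bernstein_const \<alpha> * M * cmod (z - w)"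
    by (rule bernstein_at_zero[OF holomorphic_fock_shift[OF f]])
       (use M \<open>0 < \<alpha>\<close> True in \<open>auto simp: wmod_fock_shift dist_norm\<close>)
  then show ?thesis
    by (simp only: wmod_fock_shift) (simp add: dist_norm)
next
  case False
  have "0 \<le> M" using M[of 0] wmod_nonneg order_trans by blast
  have "1 * M * 1 \<le> bernstein_const \<alpha> * M * dist z w"
    using False \<open>0 \<le> M\<close> bernstein_const_ge_1[OF \<open>0 < \<alpha>\<close>] by (intro mult_mono) auto
  moreover have "\<bar>wmod \<alpha> f z - wmod \<alpha> f w\<bar> \<le> M"
    using M[of z] M[of w] wmod_nonneg[of \<alpha> f z] wmod_nonneg[of \<alpha> f w] by linarith
  ultimately show ?thesis by linarith
qed

section \<open>Uniformly discrete subsets\<close>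

text \<open>The bound is uniform in the centre because a finite cover of one ball by balls of half the
  separation can be translated, and each of the small balls holds at most one point.\<close>

lemma uniform_discrete_card_cball_le:
  fixes \<Gamma> :: "'a::euclidean_space set"
  assumes "uniform_discrete \<Gamma>"
  obtains m where "\<And>w. finite (\<Gamma> \<inter> cball w R)" "\<And>w. card (\<Gamma> \<inter> cball w R) \<le> m"
proof -
  obtain e where e: "e > 0" "\<And>x y. x \<in> \<Gamma> \<Longrightarrow> y \<in> \<Gamma> \<Longrightarrow> dist x y < e \<Longrightarrow> x = y"
    using assms by (auto simp: uniform_discrete_def)
  obtain k where k: "finite k" "cball (0::'a) R \<subseteq> (\<Union>x\<in>k. ball x (e / 2))"
    using compact_imp_seq_compact[OF compact_cball[of "0::'a" R]] e(1)
      seq_compact_imp_totally_bounded[of "cball (0::'a) R"] half_gt_zero by metis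
  have "finite (\<Gamma> \<inter> cball w R) \<and> card (\<Gamma> \<inter> cball w R) \<le> card k" for w
  proof -
    have "\<forall>x\<in>\<Gamma> \<inter> cball w R. \<exists>c\<in>k. dist c (x - w) < e / 2"
    proof
      fix x assume "x \<in> \<Gamma> \<inter> cball w R"
      then have "x - w \<in> cball 0 R" by (simp add: dist_norm norm_minus_commute)
      then obtain c where "c \<in> k" "x - w \<in> ball c (e / 2)" using k(2) by blast
      then show "\<exists>c\<in>k. dist c (x - w) < e / 2" unfolding mem_ball by blast
    qed
    then obtain c where c: "\<And>x. x \<in> \<Gamma> \<inter> cball w R \<Longrightarrow> c x \<in> k \<and> dist (c x) (x - w) < e / 2"
      by metis
    have inj: "inj_on c (\<Gamma> \<inter> cball w R)"
    proof (rule inj_onI)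
      fix x y assume x: "x \<in> \<Gamma> \<inter> cball w R" and y: "y \<in> \<Gamma> \<inter> cball w R" and "c x = c y"
      then have "dist (x - w) (y - w) < e"
        using c[OF x] c[OF y] dist_triangle_half_r[of "c x" "x - w" e "y - w"] by simp
      then show "x = y" using e(2) x y by (simp add: dist_norm)
    qed
    have im: "c ` (\<Gamma> \<inter> cball w R) \<subseteq> k" using c by auto
    show ?thesis
      using inj im k(1) by (meson card_inj_on_le inj_on_finite)
  qed
  then show ?thesis using that by blast
qed

lemma uniform_discrete_finite_Int_bounded:
  fixes \<Gamma> :: "'a::euclidean_space set"
  assumes "uniform_discrete \<Gamma>" "bounded X"
  shows "finite (\<Gamma> \<inter> X)"
proof -
  obtain B where "\<forall>x\<in>X. dist 0 x \<le> B" using assms(2) bounded_any_center by blast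
  then have "\<Gamma> \<inter> X \<subseteq> \<Gamma> \<inter> cball 0 B" by auto
  moreover have "finite (\<Gamma> \<inter> cball 0 B)"
    using uniform_discrete_card_cball_le[OF assms(1)] by blast
  ultimately show ?thesis by (rule finite_subset)
qed

lemma ex_maximal_separated_subset:
  fixes \<Gamma> :: "'a::metric_space set"
  assumes "e > 0"
  obtains \<Delta> where "\<Delta> \<subseteq> \<Gamma>" "\<And>x y. x \<in> \<Delta> \<Longrightarrow> y \<in> \<Delta> \<Longrightarrow> dist x y < e \<Longrightarrow> x = y"
    "\<And>x. x \<in> \<Gamma> \<Longrightarrow> \<exists>y\<in>\<Delta>. dist x y < e"
proof -
  define S where "S = {\<Delta>. \<Delta> \<subseteq> \<Gamma> \<and> (\<forall>x\<in>\<Delta>. \<forall>y\<in>\<Delta>. dist x y < e \<longrightarrow> x = y)}"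
  have "\<exists>M\<in>S. \<forall>X\<in>S. M \<subseteq> X \<longrightarrow> X = M"
  proof (rule subset_Zorn')
    fix C assume C: "subset.chain S C"
    then have CS: "C \<subseteq> S" and lin: "\<And>X Y. X \<in> C \<Longrightarrow> Y \<in> C \<Longrightarrow> X \<subseteq> Y \<or> Y \<subseteq> X"
      by (auto simp: subset_chain_def)
    have "x = y" if "X \<in> C" "Y \<in> C" "x \<in> X" "y \<in> Y" "dist x y < e" for X Y x y
      using lin[OF that(1,2)] that CS unfolding S_def by blast
    then show "\<Union>C \<in> S" using CS by (auto simp: S_def)
  qed
  then obtain \<Delta> where \<Delta>: "\<Delta> \<in> S" and max: "\<And>X. X \<in> S \<Longrightarrow> \<Delta> \<subseteq> X \<Longrightarrow> X = \<Delta>" by blast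
  have "\<exists>y\<in>\<Delta>. dist x y < e" if x: "x \<in> \<Gamma>" for x
  proof (rule ccontr)
    assume no: "\<not> (\<exists>y\<in>\<Delta>. dist x y < e)"
    then have "insert x \<Delta> \<in> S"
      using \<Delta> x by (auto simp: S_def dist_commute)
    then have "x \<in> \<Delta>" using max by blast
    then show False using no \<open>e > 0\<close> by force
  qed
  then show ?thesis using \<Delta> by (intro that[of \<Delta>]) (auto simp: S_def)
qed

text \<open>A maximal \<open>e\<close>-separated subset comes within \<open>e\<close> of every point of \<open>\<Gamma>\<close>. By the Bernstein
  inequality, passing to it changes the supremum over \<open>\<Gamma>\<close> by a small multiple of the norm.\<close>

lemma samples_uniform_discrete_subset:
  assumes "0 < \<alpha>" "0 < K" "samples \<alpha> K \<Gamma>"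
  obtains \<Delta> where "\<Delta> \<subseteq> \<Gamma>" "uniform_discrete \<Delta>" "samples \<alpha> (2 * K) \<Delta>"
proof -
  define C where "C = bernstein_const \<alpha>"
  have C: "C \<ge> 1" unfolding C_def by (rule bernstein_const_ge_1) fact
  \<comment> \<open>chosen so that the error \<open>C * M * e\<close>, once multiplied by \<open>K\<close>, is \<open>M / 2\<close>\<close>
  define e where "e = 1 / (2 * K * C)"
  have e: "e > 0" "K * C * e = 1 / 2" using C \<open>0 < K\<close> by (auto simp: e_def)
  obtain \<Delta> where \<Delta>: "\<Delta> \<subseteq> \<Gamma>" "\<And>x y. x \<in> \<Delta> \<Longrightarrow> y \<in> \<Delta> \<Longrightarrow> dist x y < e \<Longrightarrow> x = y"
    "\<And>x. x \<in> \<Gamma> \<Longrightarrow> \<exists>y\<in>\<Delta>. dist x y < e"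
    using ex_maximal_separated_subset[OF e(1)] by blast
  have "samples \<alpha> (2 * K) \<Delta>"
  proof (rule samples_by_contraction[OF \<open>0 < K\<close>])
    fix f M s z
    assume f: "f holomorphic_on UNIV" and M: "\<And>z. wmod \<alpha> f z \<le> M"
      and s: "0 \<le> s" "\<And>z. z \<in> \<Delta> \<Longrightarrow> wmod \<alpha> f z \<le> s"
    have M0: "0 \<le> M" using M[of 0] wmod_nonneg order_trans by blast
    have "wmod \<alpha> f x \<le> s + C * M * e" if x: "x \<in> \<Gamma>" for x
    proof -
      obtain y where y: "y \<in> \<Delta>" "dist x y < e" using \<Delta>(3)[OF x] by blast
      have "\<bar>wmod \<alpha> f x - wmod \<alpha> f y\<bar> \<le> C * M * dist x y"
        unfolding C_def by (rule bernstein[OF f M \<open>0 < \<alpha>\<close>])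
      also have "\<dots> \<le> C * M * e"
        using y(2) C M0 by (intro mult_left_mono) auto
      finally show ?thesis using s(2)[OF y(1)] by linarith
    qed
    then have "wmod \<alpha> f z \<le> K * (s + C * M * e)"
      using s(1) C M0 e(1) by (intro samplesD[OF assms(3) f M]) auto
    also have "\<dots> = K * s + M * (K * C * e)" by (simp add: algebra_simps)
    finally show "wmod \<alpha> f z \<le> K * s + M / 2" by (simp add: e(2))
  qed
  moreover have "uniform_discrete \<Delta>"
    using \<Delta>(2) e(1) by (auto simp: uniform_discrete_def)
  ultimately show ?thesis using that \<Delta>(1) by blast
qed

section \<open>Stability of sampling under a small increase of the exponent\<close>

text \<open>Parameters of the gliding hump used in \<open>samples_larger_exponent\<close>. The dilation factors \<open>r j\<close> are so
  close to \<open>1\<close>, relative to the radii \<open>\<rho> j\<close>, that dilating by \<open>r j\<close> moves no point of the disc of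
  radius \<open>\<rho> j\<close> noticeably, while the decay gained by the dilation is complete beyond radius
  \<open>\<rho> (Suc j)\<close>. Choosing \<open>\<rho> j\<close>, then \<open>r j\<close>, then \<open>\<rho> (Suc j)\<close> makes both conditions possible.\<close>

lemma ex_hump_parameters:
  fixes \<alpha> \<eta> C :: real
  assumes "0 < \<alpha>" "0 < \<eta>" "1 \<le> C"
  obtains \<rho> r :: "nat \<Rightarrow> real" where "\<And>j. 0 < \<rho> j" "\<And>j. \<rho> j \<le> \<rho> (Suc j)"
    "\<And>j. 0 < r j" "\<And>j. r j < 1" "\<And>j. C * (1 - r j) * \<rho> j \<le> \<eta>"
    "\<And>j. exp (- \<alpha> * (1 - (r j)\<^sup>2) * (\<rho> (Suc j))\<^sup>2 / 4) \<le> \<eta>"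
proof -
  define P :: "real \<times> real \<Rightarrow> bool" where
    "P x \<longleftrightarrow> 0 < fst x \<and> 0 < snd x \<and> snd x < 1 \<and> C * (1 - snd x) * fst x \<le> \<eta>" for x
  define Q :: "real \<times> real \<Rightarrow> real \<times> real \<Rightarrow> bool" where
    "Q x y \<longleftrightarrow> fst x \<le> fst y \<and> exp (- \<alpha> * (1 - (snd x)\<^sup>2) * (fst y)\<^sup>2 / 4) \<le> \<eta>" for x y
  have ex_P: "\<exists>r. P (\<rho>, r)" if "0 < \<rho>" for \<rho>
  proof -
    define d where "d = min (1/2) (\<eta> / (C * \<rho>))"
    have d: "0 < d" "d < 1" using assms that by (auto simp: d_def)
    have "C * \<rho> * d \<le> C * \<rho> * (\<eta> / (C * \<rho>))"
      using assms that by (intro mult_left_mono) (auto simp: d_def)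
    also have "\<dots> = \<eta>" using assms that by simp
    finally have "P (\<rho>, 1 - d)" using d that by (simp add: P_def mult_ac)
    then show ?thesis by blast
  qed
  have ex_Q: "\<exists>y. P y \<and> Q x y" if "P x" for x
  proof -
    \<comment> \<open>the radius is at least \<open>1\<close>, so the linear bound on \<open>A * \<rho>'\<close> suffices\<close>
    define A where "A = \<alpha> * (1 - (snd x)\<^sup>2) / 4"
    have "(snd x)\<^sup>2 < 1" using that by (auto simp: P_def power_less_one_iff)
    then have A: "0 < A" using assms by (simp add: A_def)
    define \<rho>' where "\<rho>' = max (fst x) (max 1 (\<bar>ln \<eta>\<bar> / A))"
    have \<rho>': "0 < \<rho>'" "fst x \<le> \<rho>'" "1 \<le> \<rho>'" "\<bar>ln \<eta>\<bar> / A \<le> \<rho>'" by (auto simp: \<rho>'_def)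
    have "\<bar>ln \<eta>\<bar> \<le> A * \<rho>'" using \<rho>'(4) A by (simp add: field_simps)
    also have "\<dots> \<le> A * \<rho>'\<^sup>2"
      using \<rho>'(3) A by (intro mult_left_mono) (auto simp: power2_eq_square)
    finally have "- (A * \<rho>'\<^sup>2) \<le> ln \<eta>" by linarith
    then have "exp (- (A * \<rho>'\<^sup>2)) \<le> \<eta>" using assms by (metis exp_le_cancel_iff exp_ln)
    moreover have "- \<alpha> * (1 - (snd x)\<^sup>2) * \<rho>'\<^sup>2 / 4 = - (A * \<rho>'\<^sup>2)" by (simp add: A_def)
    ultimately have "exp (- \<alpha> * (1 - (snd x)\<^sup>2) * \<rho>'\<^sup>2 / 4) \<le> \<eta>" by (simp only:)
    then show ?thesis using ex_P[OF \<rho>'(1)] \<rho>'(2) by (force simp: Q_def)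
  qed
  obtain f where f: "\<And>n. P (f n) \<and> Q (f n) (f (Suc n))"
    using dependent_nat_choice[of "\<lambda>n. P" "\<lambda>n. Q"] ex_P[of 1] ex_Q by auto
  show ?thesis
    by (rule that[of "\<lambda>j. fst (f j)" "\<lambda>j. snd (f j)"]) (use f in \<open>auto simp: P_def Q_def\<close>)
qed

text \<open>The intervals between consecutive \<open>\<rho> j\<close> are disjoint, so \<open>x\<close> lies in at most one of them and at most
  one summand violates the small bound.\<close>

lemma sum_le_if_disjoint_exceptions:
  fixes t :: "nat \<Rightarrow> real" and \<rho> :: "nat \<Rightarrow> real"
  assumes mono: "\<And>j. \<rho> j \<le> \<rho> (Suc j)" and "0 \<le> M"
    and small: "\<And>j. j < J \<Longrightarrow> x \<le> \<rho> j \<or> \<rho> (Suc j) \<le> x \<Longrightarrow> t j \<le> a"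
    and bound: "\<And>j. j < J \<Longrightarrow> t j \<le> a + M"
  shows "(\<Sum>j<J. t j) \<le> real J * a + M"
proof -
  define B where "B = {j. j < J \<and> \<rho> j < x \<and> x < \<rho> (Suc j)}"
  have inc: "\<rho> i \<le> \<rho> j" if "i \<le> j" for i j
    using lift_Suc_mono_le[of \<rho>, OF mono that] .
  have "i = j" if "i \<in> B" "j \<in> B" for i j
    using that inc[of "Suc i" j] inc[of "Suc j" i] by (force simp: B_def not_less_eq_eq)
  moreover have "finite B" by (simp add: B_def)
  ultimately have cardB: "card B \<le> 1"
    by (simp add: card_le_Suc0_iff_eq)
  have "(\<Sum>j<J. t j) \<le> (\<Sum>j<J. a + (if j \<in> B then M else 0))"
    by (intro sum_mono) (use small bound in \<open>auto simp: B_def not_less\<close>)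
  also have "\<dots> = real J * a + real (card B) * M"
    using \<open>finite B\<close> by (subst sum.distrib) (simp add: sum.If_cases B_def Int_def conj_commute)
  also have "\<dots> \<le> real J * a + 1 * M"
    using cardB \<open>0 \<le> M\<close> by (intro add_left_mono mult_right_mono) auto
  finally show ?thesis by simp
qed

text \<open>Dilating by \<open>r < 1\<close> gains a Gaussian factor with exponent of order \<open>\<alpha> * (1 - r\<^sup>2)\<close>. Half of this gain
  pays for lowering the exponent from \<open>\<alpha> + \<epsilon>\<close> to \<open>\<alpha>\<close>; the other half is left as decay.\<close>

lemma wmod_dilate_le:
  assumes "0 < \<alpha>" "0 \<le> r" "\<epsilon> \<le> \<alpha> * (1 - r\<^sup>2) / 2" "r \<le> 1" "0 \<le> \<epsilon>"
  shows "wmod \<alpha> (\<lambda>z. h (of_real r * z)) z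
      \<le> wmod (\<alpha> + \<epsilon>) h (of_real r * z) * exp (- \<alpha> * (1 - r\<^sup>2) * (cmod z)\<^sup>2 / 4)"
proof -
  define e where "e = \<alpha> * (1 - r\<^sup>2)"
  have r2: "r\<^sup>2 \<le> 1" using assms by (simp add: power_le_one)
  have "\<epsilon> * r\<^sup>2 \<le> \<epsilon>" using r2 assms by (simp add: mult_left_le)
  then have *: "\<epsilon> * r\<^sup>2 \<le> e / 2" using assms by (simp add: e_def)
  have "(\<alpha> + \<epsilon>) * r\<^sup>2 = \<alpha> - e + \<epsilon> * r\<^sup>2" by (simp add: e_def algebra_simps)
  then have "(\<alpha> + \<epsilon>) * r\<^sup>2 * (cmod z)\<^sup>2 \<le> (\<alpha> - e / 2) * (cmod z)\<^sup>2"
    using * by (intro mult_right_mono) auto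
  then have "- \<alpha> * (cmod z)\<^sup>2 / 2
      \<le> - (\<alpha> + \<epsilon>) * (cmod (of_real r * z))\<^sup>2 / 2 + - e * (cmod z)\<^sup>2 / 4"
    by (simp add: norm_mult power_mult_distrib algebra_simps)
  then have "exp (- \<alpha> * (cmod z)\<^sup>2 / 2)
      \<le> exp (- (\<alpha> + \<epsilon>) * (cmod (of_real r * z))\<^sup>2 / 2) * exp (- e * (cmod z)\<^sup>2 / 4)"
    unfolding exp_add[symmetric] by simp
  then have "exp (- \<alpha> * (cmod z)\<^sup>2 / 2) * cmod (h (of_real r * z))
      \<le> exp (- (\<alpha> + \<epsilon>) * (cmod (of_real r * z))\<^sup>2 / 2) * exp (- e * (cmod z)\<^sup>2 / 4) * cmod (h (of_real r * z))"
    by (rule mult_right_mono) simp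
  then show ?thesis by (simp add: wmod_def e_def mult_ac)
qed

lemma wmod_average_le:
  assumes "0 < J"
  shows "wmod \<alpha> (\<lambda>z. (\<Sum>j<J. h j z) / of_nat J) z \<le> (\<Sum>j<J. wmod \<alpha> (h j) z) / real J"
  unfolding wmod_def norm_divide norm_of_nat sum_distrib_left[symmetric] times_divide_eq_right
  by (intro divide_right_mono mult_left_mono norm_sum) auto

text \<open>Functions of the larger space have to be tested against a sampling inequality that is known only for
  the smaller one. Let \<open>h\<close> be in the larger space and small on the set. Each dilate \<open>h (r j * z)\<close> is in
  the smaller space and agrees with \<open>h\<close> at the origin; on the set it is small except in the annulus
  between \<open>\<rho> j\<close> and \<open>\<rho> (Suc j)\<close>, since within radius \<open>\<rho> j\<close>
  it is close to \<open>h\<close> and beyond radius \<open>\<rho> (Suc j)\<close> it has decayed.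
  The annuli are disjoint, so the average of \<open>J\<close> such dilates is small on the whole set, up to an
  error \<open>M / J\<close>, and sampling bounds its value at the origin, which is that of \<open>h\<close>. The number \<open>J\<close> and
  the dilations depend only on \<open>\<alpha>\<close> and \<open>K\<close>, and so does the admissible increase of the exponent.\<close>

lemma samples_larger_exponent:
  assumes "0 < \<alpha>" "0 < K" "samples \<alpha> K \<Gamma>"
  obtains \<beta> L where "\<alpha> < \<beta>" "0 < L" "samples \<beta> L \<Gamma>"
proof -
  define C where "C = bernstein_const (2 * \<alpha>)"
  have C: "1 \<le> C" unfolding C_def using assms by (intro bernstein_const_ge_1) auto
  \<comment> \<open>the errors \<open>\<eta> * M\<close> and \<open>M / J\<close> contribute at most \<open>M / 4\<close> each after multiplication by \<open>K\<close>\<close>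
  define \<eta> where "\<eta> = 1 / (4 * K)"
  have \<eta>: "0 < \<eta>" using assms by (simp add: \<eta>_def)
  obtain J :: nat where J: "4 * K < real J" using reals_Archimedean2 by blast
  have J0: "0 < J" using J assms by (cases J) auto
  obtain \<rho> r :: "nat \<Rightarrow> real" where \<rho>: "\<And>j. 0 < \<rho> j" "\<And>j. \<rho> j \<le> \<rho> (Suc j)"
    and r: "\<And>j. 0 < r j" "\<And>j. r j < 1"
    and near: "\<And>j. C * (1 - r j) * \<rho> j \<le> \<eta>"
    and far: "\<And>j. exp (- \<alpha> * (1 - (r j)\<^sup>2) * (\<rho> (Suc j))\<^sup>2 / 4) \<le> \<eta>"
    using ex_hump_parameters[OF \<open>0 < \<alpha>\<close> \<eta> C] by blast
  have r2: "(r j)\<^sup>2 < 1" for j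
    using r[of j] by (simp add: power_less_one_iff)
  \<comment> \<open>inserting \<open>\<alpha>\<close> keeps the new exponent at most \<open>2 * \<alpha>\<close>, where \<open>C\<close> is a valid Bernstein constant\<close>
  define \<epsilon> where "\<epsilon> = Min (insert \<alpha> ((\<lambda>j. \<alpha> * (1 - (r j)\<^sup>2) / 2) ` {..<J}))"
  have \<epsilon>: "0 < \<epsilon>" "\<epsilon> \<le> \<alpha>" "\<And>j. j < J \<Longrightarrow> \<epsilon> \<le> \<alpha> * (1 - (r j)\<^sup>2) / 2"
    subgoal using r2 \<open>0 < \<alpha>\<close> by (simp add: \<epsilon>_def)
    subgoal by (simp add: \<epsilon>_def)
    subgoal unfolding \<epsilon>_def by (intro Min_le) auto
    done
  define \<beta> where "\<beta> = \<alpha> + \<epsilon>"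
  have \<beta>: "\<alpha> < \<beta>" "\<beta> \<le> 2 * \<alpha>" "0 < \<beta>" using \<epsilon> \<open>0 < \<alpha>\<close> by (auto simp: \<beta>_def)
  have "samples \<beta> (2 * K) \<Gamma>"
  proof (rule samples_by_contraction[OF \<open>0 < K\<close>])
    fix f M s z0
    assume f: "f holomorphic_on UNIV" and M: "\<And>z. wmod \<beta> f z \<le> M"
      and s: "0 \<le> s" "\<And>z. z \<in> \<Gamma> \<Longrightarrow> wmod \<beta> f z \<le> s"
    have M0: "0 \<le> M" using M[of 0] wmod_nonneg order_trans by blast
    define h where "h = fock_shift \<beta> z0 f"
    have h: "h holomorphic_on UNIV" unfolding h_def by (rule holomorphic_fock_shift[OF f])
    have hM: "wmod \<beta> h z \<le> M" for z using M by (simp add: h_def wmod_fock_shift)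
    define hh where "hh j z = h (of_real (r j) * z)" for j z
    define g where "g z = (\<Sum>j<J. hh j z) / of_nat J" for z
    have hh_hol: "hh j holomorphic_on UNIV" for j
      unfolding hh_def[abs_def]
      by (rule holomorphic_on_compose_gen[OF _ h, unfolded o_def]) (auto intro!: holomorphic_intros)
    have g: "g holomorphic_on UNIV"
      unfolding g_def[abs_def] using hh_hol J0 by (auto intro!: holomorphic_intros)
    have hump: "wmod \<alpha> (hh j) z \<le> wmod \<beta> h (of_real (r j) * z) * exp (- \<alpha> * (1 - (r j)\<^sup>2) * (cmod z)\<^sup>2 / 4)"
      if "j < J" for j z
      unfolding hh_def \<beta>_def
      by (rule wmod_dilate_le) (use \<epsilon> that r[of j] \<open>0 < \<alpha>\<close> in auto)
    have exp_le1: "exp (- \<alpha> * (1 - (r j)\<^sup>2) * (cmod z)\<^sup>2 / 4) \<le> 1" for j z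
      using r2[of j] \<open>0 < \<alpha>\<close> by simp
    have hump_M: "wmod \<alpha> (hh j) z \<le> M" if "j < J" for j z
    proof -
      have "wmod \<alpha> (hh j) z \<le> M * 1"
        by (intro order_trans[OF hump[OF that]] mult_mono hM exp_le1 M0) auto
      then show ?thesis by simp
    qed
    have avg: "wmod \<alpha> g z \<le> (\<Sum>j<J. wmod \<alpha> (hh j) z) / real J" for z
      unfolding g_def[abs_def] by (rule wmod_average_le[OF J0])
    have gM: "wmod \<alpha> g z \<le> M" for z
    proof -
      have "(\<Sum>j<J. wmod \<alpha> (hh j) z) \<le> (\<Sum>j<J. M)" using hump_M by (intro sum_mono) auto
      then have "(\<Sum>j<J. wmod \<alpha> (hh j) z) / real J \<le> M" using J0 by (simp add: field_simps)
      then show ?thesis using avg[of z] by linarith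
    qed
    have g\<Gamma>: "wmod \<alpha> g z \<le> s + \<eta> * M + M / real J" if z: "z \<in> {z. z + z0 \<in> \<Gamma>}" for z
    proof -
      have hs: "wmod \<beta> h z \<le> s" using s(2) z by (simp add: h_def wmod_fock_shift)
      have "(\<Sum>j<J. wmod \<alpha> (hh j) z) \<le> real J * (s + \<eta> * M) + M"
      proof (rule sum_le_if_disjoint_exceptions[where \<rho> = \<rho> and x = "cmod z"])
        fix j assume j: "j < J"
        show "wmod \<alpha> (hh j) z \<le> s + \<eta> * M + M"
          using hump_M[OF j, of z] s(1) \<eta> M0 by (simp add: add_nonneg_nonneg add_increasing)
        assume "cmod z \<le> \<rho> j \<or> \<rho> (Suc j) \<le> cmod z"
        then show "wmod \<alpha> (hh j) z \<le> s + \<eta> * M"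
        proof
          assume zj: "cmod z \<le> \<rho> j"
          have "dist (of_real (r j) * z) z = cmod (of_real (r j - 1) * z)"
            by (simp add: dist_norm algebra_simps)
          also have "\<dots> = (1 - r j) * cmod z" using r(2)[of j] by (simp only: norm_mult norm_of_real abs_if) simp
          finally have d: "dist (of_real (r j) * z) z = (1 - r j) * cmod z" .
          have "\<bar>wmod \<beta> h (of_real (r j) * z) - wmod \<beta> h z\<bar>
              \<le> bernstein_const \<beta> * M * ((1 - r j) * cmod z)"
            using bernstein[OF h hM \<beta>(3), of "of_real (r j) * z" z] d by simp
          also have "\<dots> \<le> C * M * ((1 - r j) * \<rho> j)"
            unfolding C_def using zj M0 r[of j] \<beta> bernstein_const_mono[of \<beta> "2 * \<alpha>"]
              bernstein_const_ge_1[of \<beta>] bernstein_const_ge_1[of "2 * \<alpha>"]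
            by (intro mult_mono) auto
          also have "\<dots> = C * (1 - r j) * \<rho> j * M" by (simp add: mult_ac)
          also have "\<dots> \<le> \<eta> * M" using near M0 by (intro mult_right_mono) auto
          finally have "wmod \<beta> h (of_real (r j) * z) \<le> s + \<eta> * M" using hs by linarith
          then show ?thesis
            using hump[OF j, of z] mult_left_le[OF exp_le1[of j z], of "wmod \<beta> h (of_real (r j) * z)"]
            by simp
        next
          assume zj: "\<rho> (Suc j) \<le> cmod z"
          have "(\<rho> (Suc j))\<^sup>2 \<le> (cmod z)\<^sup>2" using zj \<rho>(1)[of "Suc j"] by (intro power_mono) auto
          then have "\<alpha> * (1 - (r j)\<^sup>2) * (\<rho> (Suc j))\<^sup>2 \<le> \<alpha> * (1 - (r j)\<^sup>2) * (cmod z)\<^sup>2"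
            using r2[of j] \<open>0 < \<alpha>\<close> by (intro mult_left_mono) auto
          then have "exp (- \<alpha> * (1 - (r j)\<^sup>2) * (cmod z)\<^sup>2 / 4) \<le> \<eta>"
            using far[of j] by (intro order_trans[OF _ far[of j]]) simp
          then have "wmod \<alpha> (hh j) z \<le> M * \<eta>"
            by (intro order_trans[OF hump[OF j]] mult_mono hM M0) auto
          then show ?thesis using s(1) by (simp add: mult.commute)
        qed
      qed (use \<rho> M0 in auto)
      then have "(\<Sum>j<J. wmod \<alpha> (hh j) z) / real J \<le> (real J * (s + \<eta> * M) + M) / real J"
        by (intro divide_right_mono) auto
      also have "\<dots> = s + \<eta> * M + M / real J" using J0 by (simp add: field_simps)
      finally show ?thesis using avg[of z] by linarith
    qed
    have "wmod \<alpha> g 0 \<le> K * (s + \<eta> * M + M / real J)"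
      using s(1) \<eta> M0
      by (intro samplesD[OF samples_translate[OF assms(3), of z0] g gM _ g\<Gamma>]) auto
    also have "wmod \<alpha> g 0 = wmod \<beta> h 0"
      using J0 by (simp add: g_def hh_def)
    also have "\<dots> = wmod \<beta> f z0" by (simp only: h_def wmod_fock_shift) simp
    also have "K * (s + \<eta> * M + M / real J) = K * s + M / 4 + K / real J * M"
      using \<open>0 < K\<close> by (simp add: \<eta>_def algebra_simps)
    also have "K / real J * M \<le> 1 / 4 * M"
      using J \<open>0 < K\<close> J0 M0 by (intro mult_right_mono) (auto simp: field_simps)
    finally show "wmod \<beta> f z0 \<le> K * s + M / 2" by simp
  qed
  then show ?thesis using that[of \<beta> "2 * K"] \<beta>(1) \<open>0 < K\<close> by simp
qed

section \<open>Sampling sets have many points in every disc\<close>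

text \<open>The Bernstein--Walsh inequality for a disc: the reversed polynomial \<open>z ^ card Z * p (1 / z)\<close> obeys the
  maximum principle in the disc of radius \<open>1 / \<rho>\<close>.\<close>

lemma prod_linear_growth:
  fixes Z :: "complex set"
  assumes "finite Z" "0 < \<rho>" and B: "\<And>z. cmod z = \<rho> \<Longrightarrow> cmod (\<Prod>a\<in>Z. z - a) \<le> B"
    and z: "\<rho> \<le> cmod z"
  shows "cmod (\<Prod>a\<in>Z. z - a) \<le> (cmod z / \<rho>) ^ card Z * B"
proof -
  define q where "q u = (\<Prod>a\<in>Z. 1 - a * u)" for u
  have q: "(\<Prod>a\<in>Z. x - a) = x ^ card Z * q (1 / x)" if "x \<noteq> 0" for x
  proof -
    have "(\<Prod>a\<in>Z. x - a) = (\<Prod>a\<in>Z. x * (1 - a * (1 / x)))"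
      using that by (intro prod.cong) (auto simp: algebra_simps)
    then show ?thesis by (simp add: prod.distrib q_def)
  qed
  have "cmod (q (1 / z)) \<le> B / \<rho> ^ card Z"
  proof (rule maximum_modulus_frontier[where S = "cball 0 (1 / \<rho>)" and f = q])
    show "1 / z \<in> cball 0 (1 / \<rho>)"
      using z \<open>0 < \<rho>\<close> by (simp add: norm_divide frac_le)
    fix u :: complex assume "u \<in> frontier (cball 0 (1 / \<rho>))"
    then have u: "cmod u = 1 / \<rho>" "u \<noteq> 0" using \<open>0 < \<rho>\<close> by auto
    have "cmod (\<Prod>a\<in>Z. 1 / u - a) \<le> B" using u \<open>0 < \<rho>\<close> by (intro B) (simp add: norm_divide)
    then have "\<rho> ^ card Z * cmod (q u) \<le> B"
      using q[of "1 / u"] u \<open>0 < \<rho>\<close> by (simp add: norm_mult norm_power norm_divide)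
    then show "cmod (q u) \<le> B / \<rho> ^ card Z" using \<open>0 < \<rho>\<close> by (simp add: field_simps)
  qed (auto simp: q_def[abs_def] intro!: holomorphic_intros continuous_intros)
  moreover have "z \<noteq> 0" using z \<open>0 < \<rho>\<close> by auto
  ultimately have "cmod (\<Prod>a\<in>Z. z - a) \<le> cmod z ^ card Z * (B / \<rho> ^ card Z)"
    unfolding q[OF \<open>z \<noteq> 0\<close>] norm_mult norm_power by (intro mult_left_mono) auto
  then show ?thesis by (simp add: power_divide)
qed

text \<open>With \<open>u = t / \<rho>\<close> this is \<open>ln u \<le> u - 1\<close>, since the quadratic terms combine to the
  square of \<open>t - \<rho>\<close>. The condition on \<open>m\<close> says that the weighted monomial of degree \<open>m\<close> has passed its
  maximum at radius \<open>\<rho>\<close>.\<close>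

lemma gaussian_tail:
  fixes \<beta> \<rho> t :: real
  assumes "0 < \<beta>" "0 < \<rho>" "\<rho> \<le> t" "real m \<le> \<beta> * \<rho>\<^sup>2"
  shows "(t / \<rho>) ^ m * exp (- \<beta> * t\<^sup>2 / 2) \<le> exp (- \<beta> * \<rho>\<^sup>2 / 2) * exp (- \<beta> * (t - \<rho>)\<^sup>2 / 2)"
proof -
  define u where "u = t / \<rho>"
  have u: "1 \<le> u" "t = u * \<rho>" using assms by (auto simp: u_def)
  have "real m * ln u \<le> \<beta> * \<rho>\<^sup>2 * (u - 1)"
    using u assms ln_le_minus_one[of u] by (intro mult_mono) auto
  also have "\<beta> * \<rho>\<^sup>2 * (u - 1) = \<beta> * t\<^sup>2 / 2 - \<beta> * \<rho>\<^sup>2 / 2 - \<beta> * (t - \<rho>)\<^sup>2 / 2"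
    unfolding u(2) by (simp add: power2_eq_square field_simps)
  finally have "exp (real m * ln u + - \<beta> * t\<^sup>2 / 2) \<le> exp (- \<beta> * \<rho>\<^sup>2 / 2 + - \<beta> * (t - \<rho>)\<^sup>2 / 2)"
    by simp
  moreover have "exp (real m * ln u) = u ^ m"
    using u by (simp add: exp_of_nat_mult)
  ultimately show ?thesis by (simp only: exp_add u_def)
qed

text \<open>If the disc contained fewer points, the monic polynomial with these points as zeros would have so
  small a degree that its weighted modulus is concentrated in the disc of radius \<open>R - c\<close>. At all points
  of \<open>\<Gamma>\<close> it would then either vanish or be smaller than its norm by the factor
  \<open>exp (- \<beta> * c\<^sup>2 / 2)\<close>, which the sampling constant cannot compensate.\<close>

lemma samples_card_cball:
  assumes "0 < \<beta>" "samples \<beta> K \<Gamma>" and c: "K * exp (- \<beta> * c\<^sup>2 / 2) < 1" "0 \<le> c" "c < R"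
    and fin: "finite (\<Gamma> \<inter> cball w R)"
  shows "\<beta> * (R - c)\<^sup>2 \<le> real (card (\<Gamma> \<inter> cball w R))"
proof (rule ccontr)
  assume few: "\<not> ?thesis"
  define \<rho> where "\<rho> = R - c"
  have \<rho>: "0 < \<rho>" using c by (simp add: \<rho>_def)
  define Z where "Z = (\<lambda>z. z - w) ` (\<Gamma> \<inter> cball w R)"
  have Z: "finite Z" unfolding Z_def using fin by simp
  have "card Z = card (\<Gamma> \<inter> cball w R)"
    unfolding Z_def by (rule card_image) (auto simp: inj_on_def)
  then have cardZ: "real (card Z) \<le> \<beta> * \<rho>\<^sup>2" using few by (simp add: \<rho>_def)
  \<comment> \<open>its degree satisfies the hypothesis of \<open>gaussian_tail\<close>, so beyond radius \<open>\<rho>\<close> it decays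
    like a Gaussian in the distance to the disc\<close>
  define p where "p z = (\<Prod>a\<in>Z. z - a)" for z
  have p: "p holomorphic_on UNIV" unfolding p_def[abs_def] by (auto intro!: holomorphic_intros)
  have contp: "continuous_on S p" for S
    using holomorphic_on_imp_continuous_on[OF p] continuous_on_subset by blast
  have "\<exists>x\<in>sphere 0 \<rho>. \<forall>y\<in>sphere 0 \<rho>. cmod (p y) \<le> cmod (p x)"
    using \<rho> by (intro continuous_attains_sup continuous_intros contp) auto
  then obtain x where x: "cmod x = \<rho>" and max: "\<And>y. cmod y = \<rho> \<Longrightarrow> cmod (p y) \<le> cmod (p x)"
    by auto
  have tail: "wmod \<beta> p z \<le> exp (- \<beta> * (cmod z - \<rho>)\<^sup>2 / 2) * wmod \<beta> p x" if "\<rho> \<le> cmod z" for z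
  proof -
    have "cmod (p z) \<le> (cmod z / \<rho>) ^ card Z * cmod (p x)"
      unfolding p_def using max that \<rho> Z by (intro prod_linear_growth) (auto simp: p_def)
    then have "wmod \<beta> p z \<le> exp (- \<beta> * (cmod z)\<^sup>2 / 2) * ((cmod z / \<rho>) ^ card Z * cmod (p x))"
      unfolding wmod_def by (intro mult_left_mono) auto
    also have "\<dots> = (cmod z / \<rho>) ^ card Z * exp (- \<beta> * (cmod z)\<^sup>2 / 2) * cmod (p x)" by simp
    also have "\<dots> \<le> exp (- \<beta> * \<rho>\<^sup>2 / 2) * exp (- \<beta> * (cmod z - \<rho>)\<^sup>2 / 2) * cmod (p x)"
      by (intro mult_right_mono gaussian_tail) (use assms \<rho> that cardZ in auto)
    finally show ?thesis by (simp add: wmod_def x mult_ac)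
  qed
  have bound: "wmod \<beta> p z \<le> cmod (p x)" for z
  proof (cases "cmod z \<le> \<rho>")
    case True
    have "cmod (p z) \<le> cmod (p x)"
      by (rule maximum_modulus_frontier[where S = "cball 0 \<rho>" and f = p])
         (use max True \<rho> p contp in \<open>auto intro: holomorphic_on_subset\<close>)
    then show ?thesis
      unfolding wmod_def using \<open>0 < \<beta>\<close>
      by (intro order_trans[OF mult_left_le_one_le[OF _ _ ] ]) auto
  next
    case False
    have "wmod \<beta> p z \<le> 1 * wmod \<beta> p x"
      using \<open>0 < \<beta>\<close> False by (intro order_trans[OF tail] mult_right_mono) auto
    also have "\<dots> \<le> cmod (p x)"
      unfolding wmod_def using \<open>0 < \<beta>\<close> by (simp add: mult_left_le_one_le)
    finally show ?thesis .
  qed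
  define s where "s = exp (- \<beta> * c\<^sup>2 / 2) * wmod \<beta> p x"
  have small: "wmod \<beta> p z \<le> s" if z: "z + w \<in> \<Gamma>" for z
  proof (cases "cmod z \<le> R")
    case True
    then have "z \<in> Z" unfolding Z_def
      using z by (intro image_eqI[of _ _ "z + w"]) (auto simp: dist_norm)
    then have "p z = 0" using Z by (auto simp: p_def)
    then show ?thesis by (simp add: wmod_def s_def)
  next
    case False
    then have "c\<^sup>2 \<le> (cmod z - \<rho>)\<^sup>2" using c by (intro power_mono) (auto simp: \<rho>_def)
    then have "exp (- \<beta> * (cmod z - \<rho>)\<^sup>2 / 2) \<le> exp (- \<beta> * c\<^sup>2 / 2)" using \<open>0 < \<beta>\<close> by simp
    then show ?thesis
      unfolding s_def using False c
      by (intro order_trans[OF tail] mult_right_mono) (auto simp: \<rho>_def)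
  qed
  have "wmod \<beta> p x \<le> K * s"
    by (rule samplesD[OF samples_translate[OF assms(2), of w] p bound]) (use small in \<open>auto simp: s_def\<close>)
  then have "wmod \<beta> p x \<le> (K * exp (- \<beta> * c\<^sup>2 / 2)) * wmod \<beta> p x" by (simp add: s_def mult_ac)
  then have "wmod \<beta> p x = 0"
    using c(1) wmod_nonneg[of \<beta> p x] mult_right_less_imp_less
    by (metis less_eq_real_def linorder_not_le mult_less_cancel_right2)
  then have px: "p x = 0" by (simp add: wmod_def)
  have "p z = 0" for z using bound[of z] px by (simp add: wmod_def mult_le_0_iff)
  then have "UNIV \<subseteq> Z" using Z by (auto simp: p_def)
  then show False using Z finite_subset infinite_UNIV_char_0 by blast
qed

section \<open>Averaging point counts over translates\<close>

text \<open>Double counting: integrating the number of points of \<open>\<Gamma>\<close> in \<open>z + E\<close> over \<open>z \<in> A\<close> counts every point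
  with weight at most the area of \<open>E\<close>, and sees only points of \<open>X\<close>. This transfers counting bounds
  between discs and dilates of \<open>I\<close> in both directions.\<close>

lemma average_count:
  fixes A E X \<Gamma> :: "complex set"
  assumes E: "compact E" and "compact A" and fin: "finite (\<Gamma> \<inter> X)"
    and sub: "\<And>z x. z \<in> A \<Longrightarrow> x \<in> E \<Longrightarrow> z + x \<in> X"
    and count: "\<And>z. z \<in> A \<Longrightarrow> k \<le> real (card {\<gamma> \<in> \<Gamma>. \<gamma> - z \<in> E})"
  shows "k * measure lebesgue A \<le> measure lebesgue E * real (card (\<Gamma> \<inter> X))"
proof -
  \<comment> \<open>the centres \<open>z\<close> whose translate \<open>z + E\<close> contains \<open>\<gamma>\<close>\<close>
  define N where "N \<gamma> = (\<lambda>x. (-1) *\<^sub>R x + \<gamma>) ` E" for \<gamma>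
  have N_iff: "z \<in> N \<gamma> \<longleftrightarrow> \<gamma> - z \<in> E" for z \<gamma>
  proof
    assume "\<gamma> - z \<in> E"
    then show "z \<in> N \<gamma>" unfolding N_def by (intro image_eqI[of _ _ "\<gamma> - z"]) auto
  qed (auto simp: N_def)
  have mN: "measure lebesgue (N \<gamma>) = measure lebesgue E" for \<gamma>
    unfolding N_def by (subst measure_lebesgue_affine) simp
  have N: "N \<gamma> \<in> lmeasurable" for \<gamma>
    unfolding N_def by (intro lmeasurable_compact compact_continuous_image continuous_intros E)
  have A: "A \<in> lmeasurable" by (rule lmeasurable_compact) fact
  have le: "k * indicator A z \<le> (\<Sum>\<gamma>\<in>\<Gamma> \<inter> X. indicator (N \<gamma>) z)" for z
  proof (cases "z \<in> A")
    case True
    have "{\<gamma> \<in> \<Gamma>. \<gamma> - z \<in> E} = {\<gamma> \<in> \<Gamma> \<inter> X. z \<in> N \<gamma>}"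
      using sub[OF True] by (force simp: N_iff)
    then have "k \<le> real (card {\<gamma> \<in> \<Gamma> \<inter> X. z \<in> N \<gamma>})" using count[OF True] by simp
    also have "\<dots> = (\<Sum>\<gamma>\<in>\<Gamma> \<inter> X. indicator (N \<gamma>) z)"
      using fin by (simp add: indicator_def sum.If_cases Int_def)
    finally show ?thesis using True by simp
  qed (auto intro!: sum_nonneg)
  have iA: "integrable lebesgue (\<lambda>z. k * indicator A z)"
    using A by (simp add: lmeasurable_iff_integrable)
  have iN: "integrable lebesgue (indicator (N \<gamma>) :: complex \<Rightarrow> real)" for \<gamma>
    using N[of \<gamma>] by (simp add: lmeasurable_iff_integrable)
  have "k * measure lebesgue A = (\<integral>z. k * indicator A z \<partial>lebesgue)"
    using A by simp
  also have "\<dots> \<le> (\<integral>z. (\<Sum>\<gamma>\<in>\<Gamma> \<inter> X. indicator (N \<gamma>) z) \<partial>lebesgue)"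
    using iA iN le by (intro integral_mono) auto
  also have "\<dots> = (\<Sum>\<gamma>\<in>\<Gamma> \<inter> X. measure lebesgue (N \<gamma>))"
    using iN N by (subst Bochner_Integration.integral_sum) auto
  also have "\<dots> = measure lebesgue E * real (card (\<Gamma> \<inter> X))" by (simp add: mN)
  finally show ?thesis .
qed

lemma measure_cball_complex: "0 \<le> r \<Longrightarrow> measure lborel (cball (c::complex) r) = pi * r\<^sup>2"
  by (simp add: content_cball unit_ball_vol_2)

lemma measure_affine_complex: "measure lebesgue ((\<lambda>z. w + r *\<^sub>R z) ` S) = r\<^sup>2 * measure lebesgue (S :: complex set)"
  using measure_lebesgue_affine[of r w S] by (simp add: add.commute)

text \<open>A single scale \<open>r\<close> at which all translates of \<open>r I\<close> contain many points already yields a bound for all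
  large discs, by averaging over the translates contained in the disc; the loss \<open>c\<close> is the radius of a
  disc around the origin containing \<open>r I\<close>.\<close>

lemma card_cball_of_lower_density:
  assumes I: "compact I" "measure lebesgue I = 1" and \<Gamma>: "uniform_discrete \<Gamma>"
    and dens: "ereal \<kappa> < lower_density I \<Gamma>"
  obtains c where "0 \<le> c" "\<And>w R. c \<le> R \<Longrightarrow> \<kappa> * pi * (R - c)\<^sup>2 \<le> real (card (\<Gamma> \<inter> cball w R))"
proof -
  have "eventually (\<lambda>r. ereal \<kappa> < ereal (real (n_minus I \<Gamma> r) / r\<^sup>2)) at_top"
    using less_LiminfD[OF dens[unfolded lower_density_def]] .
  then have "eventually (\<lambda>r. ereal \<kappa> < ereal (real (n_minus I \<Gamma> r) / r\<^sup>2) \<and> (0::real) < r) at_top"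
    using eventually_gt_at_top by (rule eventually_conj)
  then obtain r where r: "\<kappa> < real (n_minus I \<Gamma> r) / r\<^sup>2" "0 < r"
    using eventually_happens'[OF trivial_limit_at_top_linorder] by (auto simp del: less_divide_eq)
  have many: "\<kappa> * r\<^sup>2 \<le> real (card (\<Gamma> \<inter> (\<lambda>z. w + r *\<^sub>R z) ` I))" for w
  proof -
    have "n_minus I \<Gamma> r \<le> card (\<Gamma> \<inter> (\<lambda>z. w + r *\<^sub>R z) ` I)"
      unfolding n_minus_def by (rule cINF_lower) auto
    moreover have "\<kappa> * r\<^sup>2 < real (n_minus I \<Gamma> r)" using r by (simp add: pos_less_divide_eq)
    ultimately show ?thesis by linarith
  qed
  obtain B where B: "0 < B" "\<And>x. x \<in> I \<Longrightarrow> norm x \<le> B"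
    using compact_imp_bounded[OF I(1)] by (auto simp: bounded_pos)
  define c where "c = r * B"
  define E where "E = (\<lambda>z. 0 + r *\<^sub>R z) ` I"
  have E: "compact E" unfolding E_def by (intro compact_continuous_image continuous_intros I)
  have mE: "measure lebesgue E = r\<^sup>2" unfolding E_def measure_affine_complex by (simp add: I)
  have E_sub: "E \<subseteq> cball 0 c"
    using B r by (force simp: E_def c_def intro: mult_left_mono)
  have "\<kappa> * pi * (R - c)\<^sup>2 \<le> real (card (\<Gamma> \<inter> cball w R))" if "c \<le> R" for w R
  proof -
    have "\<kappa> * r\<^sup>2 * measure lebesgue (cball w (R - c)) \<le> measure lebesgue E * real (card (\<Gamma> \<inter> cball w R))"
    proof (rule average_count[OF E])
      show "finite (\<Gamma> \<inter> cball w R)"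
        using uniform_discrete_finite_Int_bounded[OF \<Gamma>] by simp
      show "z + x \<in> cball w R" if "z \<in> cball w (R - c)" "x \<in> E" for z x
        using that E_sub norm_triangle_ineq4[of "w - z" x] by (force simp: dist_norm algebra_simps)
      fix z
      have "{\<gamma> \<in> \<Gamma>. \<gamma> - z \<in> E} = \<Gamma> \<inter> (\<lambda>x. z + r *\<^sub>R x) ` I"
        unfolding E_def by (auto simp: image_iff algebra_simps)
      then show "\<kappa> * r\<^sup>2 \<le> real (card {\<gamma> \<in> \<Gamma>. \<gamma> - z \<in> E})" using many[of z] by simp
    qed simp
    then have "r\<^sup>2 * (\<kappa> * pi * (R - c)\<^sup>2) \<le> r\<^sup>2 * real (card (\<Gamma> \<inter> cball w R))"
      using that by (simp add: mE measure_cball_complex mult_ac)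
    then show ?thesis using r(2) by simp
  qed
  then show ?thesis using that[of c] B r by (simp add: c_def)
qed

text \<open>The null boundary enters here: almost all of \<open>I\<close> is interior, and inner regularity provides a compact
  part of the interior, which has positive distance to the complement.\<close>

lemma ex_interior_core:
  fixes I :: "complex set"
  assumes I: "compact I" "frontier I \<in> null_sets lebesgue" and "0 < \<eta>"
  obtains B \<rho> where "compact B" "0 < \<rho>" "\<And>x. x \<in> B \<Longrightarrow> cball x \<rho> \<subseteq> I"
    "measure lebesgue I - \<eta> \<le> measure lebesgue B"
proof -
  have U: "interior I \<in> lmeasurable"
    using I(1) by (meson bounded_subset compact_imp_bounded interior_subset lmeasurable_open open_interior)
  obtain B where B: "closed B" "B \<subseteq> interior I" "interior I - B \<in> lmeasurable"
      "emeasure lebesgue (interior I - B) < ennreal \<eta>"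
    using sets_lebesgue_inner_closed[of "interior I" \<eta>] U \<open>0 < \<eta>\<close> by (auto simp: fmeasurableD)
  have "bounded B"
    using B(2) I(1) by (meson bounded_subset compact_imp_bounded interior_subset)
  then have cB: "compact B" using B(1) by (simp add: compact_eq_bounded_closed)
  obtain \<rho> where \<rho>: "0 < \<rho>" "(\<Union>x\<in>B. cball x \<rho>) \<subseteq> interior I"
    using compact_subset_open_imp_cball_epsilon_subset[OF cB open_interior B(2)] by blast
  have "measure lebesgue (interior I) = measure lebesgue I"
    using I by (intro measure_interior) (auto simp: compact_imp_bounded negligible_iff_null_sets)
  moreover have "measure lebesgue (interior I - B) = measure lebesgue (interior I) - measure lebesgue B"
    using U cB B(2) by (intro measurable_measure_Diff) (auto simp: lmeasurable_compact fmeasurableD)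
  moreover have "measure lebesgue (interior I - B) < \<eta>"
    using B(3,4) \<open>0 < \<eta>\<close> by (simp add: emeasure_eq_measure2 ennreal_less_iff)
  ultimately have "measure lebesgue I - \<eta> \<le> measure lebesgue B" by linarith
  then show ?thesis
    using that[of B \<rho>] \<rho> interior_subset[of I] cB by auto
qed

text \<open>The translates \<open>w + r B\<close> of the dilated core \<open>B\<close> stay at distance \<open>R\<close> from the complement of
  \<open>w + r I\<close> once \<open>r * \<rho> \<ge> R\<close>, so averaging over discs of radius \<open>R\<close> centred there loses only the area of
  \<open>I\<close> outside \<open>B\<close>.\<close>

lemma lower_density_ge_of_card_cball:
  assumes I: "compact I" "measure lebesgue I = 1" "frontier I \<in> null_sets lebesgue"
    and \<Gamma>: "uniform_discrete \<Gamma>" and "0 < R" "0 \<le> k" "0 < \<eta>"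
    and count: "\<And>w. k \<le> real (card (\<Gamma> \<inter> cball w R))"
  shows "ereal (k / (pi * R\<^sup>2) * (1 - \<eta>)) \<le> lower_density I \<Gamma>"
proof -
  obtain B \<rho> where B: "compact B" "0 < \<rho>" "\<And>x. x \<in> B \<Longrightarrow> cball x \<rho> \<subseteq> I"
      "1 - \<eta> \<le> measure lebesgue B"
    using ex_interior_core[OF I(1,3) \<open>0 < \<eta>\<close>] I(2) by metis
  have bound: "k / (pi * R\<^sup>2) * (1 - \<eta>) \<le> real (n_minus I \<Gamma> r) / r\<^sup>2" if r: "R / \<rho> \<le> r" for r
  proof -
    have r0: "0 < r" using r B(2) \<open>0 < R\<close> by (meson divide_pos_pos less_le_trans)
    have Rr: "R \<le> r * \<rho>" using r B(2) by (simp add: field_simps)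
    have "\<exists>w. n_minus I \<Gamma> r = card (\<Gamma> \<inter> (\<lambda>z. w + r *\<^sub>R z) ` I)"
      unfolding n_minus_def using Inf_nat_def1[of "range (\<lambda>w. card (\<Gamma> \<inter> (\<lambda>z. w + r *\<^sub>R z) ` I))"] by auto
    then obtain w where w: "n_minus I \<Gamma> r = card (\<Gamma> \<inter> (\<lambda>z. w + r *\<^sub>R z) ` I)" by blast
    define X where "X = (\<lambda>z. w + r *\<^sub>R z) ` I"
    define A where "A = (\<lambda>z. w + r *\<^sub>R z) ` B"
    have "k * measure lebesgue A \<le> measure lebesgue (cball (0::complex) R) * real (card (\<Gamma> \<inter> X))"
    proof (rule average_count)
      show "compact A" unfolding A_def by (intro compact_continuous_image continuous_intros B(1))
      have "compact X" unfolding X_def by (intro compact_continuous_image continuous_intros I)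
      then show "finite (\<Gamma> \<inter> X)"
        using uniform_discrete_finite_Int_bounded[OF \<Gamma>] compact_imp_bounded by blast
      show "z + x \<in> X" if z: "z \<in> A" and x: "x \<in> cball 0 R" for z x
      proof -
        obtain b where b: "b \<in> B" "z = w + r *\<^sub>R b" using z by (auto simp: A_def)
        have "norm (x /\<^sub>R r) \<le> \<rho>"
          using x r0 Rr by (simp add: field_simps)
        then have "b + x /\<^sub>R r \<in> I" using B(3)[OF b(1)] by (auto simp: subset_iff dist_norm)
        then show ?thesis
          unfolding X_def using r0 b(2) by (intro image_eqI[of _ _ "b + x /\<^sub>R r"]) (auto simp: algebra_simps)
      qed
      fix z
      have "{\<gamma> \<in> \<Gamma>. \<gamma> - z \<in> cball 0 R} = \<Gamma> \<inter> cball z R"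
        by (auto simp: dist_norm norm_minus_commute)
      then show "k \<le> real (card {\<gamma> \<in> \<Gamma>. \<gamma> - z \<in> cball 0 R})" using count[of z] by simp
    qed simp
    then have 1: "k * (r\<^sup>2 * measure lebesgue B) \<le> pi * R\<^sup>2 * real (n_minus I \<Gamma> r)"
      using \<open>0 < R\<close> by (simp add: A_def measure_affine_complex measure_cball_complex w X_def)
    have "k * (r\<^sup>2 * (1 - \<eta>)) \<le> k * (r\<^sup>2 * measure lebesgue B)"
      using B(4) \<open>0 \<le> k\<close> by (intro mult_left_mono) auto
    also note 1
    finally have "k * (r\<^sup>2 * (1 - \<eta>)) \<le> pi * R\<^sup>2 * real (n_minus I \<Gamma> r)" .
    then show ?thesis using r0 \<open>0 < R\<close> by (simp add: field_simps)
  qed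
  show ?thesis
    unfolding lower_density_def
    by (intro Liminf_bounded eventually_mono[OF eventually_ge_at_top[of "R / \<rho>"]]) (use bound in auto)
qed

section \<open>Dense sets are sampling\<close>

text \<open>Jensen's inequality in multiplicative form. Each zero \<open>a\<close> is divided out and replaced by the factor
  \<open>(R\<^sup>2 - cnj a * z) / R\<close>, which has the modulus of \<open>z - a\<close> on the circle of radius \<open>R\<close>; the maximum
  principle is applied once all zeros are removed.\<close>

lemma cmod_zero_le_prod_zeros:
  fixes f :: "complex \<Rightarrow> complex"
  assumes "finite Z" "f holomorphic_on UNIV" "\<And>a. a \<in> Z \<Longrightarrow> f a = 0" "0 < R"
    and "\<And>z. cmod z = R \<Longrightarrow> cmod (f z) \<le> B"
  shows "cmod (f 0) \<le> B * (\<Prod>a\<in>Z. cmod a / R)"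
  using assms(1,2,3,5)
proof (induction Z arbitrary: f rule: finite_induct)
  case empty
  have "cmod (f 0) \<le> B"
    by (rule maximum_modulus_frontier[where S = "cball 0 R" and f = f])
       (use empty \<open>0 < R\<close> in \<open>auto intro: holomorphic_on_subset holomorphic_on_imp_continuous_on\<close>)
  then show ?case by simp
next
  case (insert a Z)
  define g where "g z = (if z = a then deriv f a else (f z - f a) / (z - a))" for z
  have g: "g holomorphic_on UNIV"
    unfolding g_def[abs_def] by (rule pole_lemma) (use insert in auto)
  have fg: "f z = (z - a) * g z" for z
    using insert.prems(2)[of a] by (simp add: g_def)
  define h where "h z = g z * ((of_real (R\<^sup>2) - cnj a * z) / of_real R)" for z
  have h: "h holomorphic_on UNIV"
    unfolding h_def[abs_def] using g \<open>0 < R\<close> by (auto intro!: holomorphic_intros)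
  have "cmod (h 0) \<le> B * (\<Prod>a\<in>Z. cmod a / R)"
  proof (rule insert.IH[OF h])
    show "h b = 0" if "b \<in> Z" for b
    proof -
      have "f b = 0" "b \<noteq> a" using that insert by auto
      then show ?thesis using fg[of b] by (simp add: h_def)
    qed
    fix z assume z: "cmod z = R"
    \<comment> \<open>on the circle \<open>R\<^sup>2 = z * cnj z\<close>, so the new factor is \<open>z * cnj (z - a) / R\<close>\<close>
    have "complex_of_real (R\<^sup>2) = z * cnj z"
      by (simp add: complex_norm_square[symmetric] z)
    then have "of_real (R\<^sup>2) - cnj a * z = z * cnj (z - a)" by (simp add: algebra_simps)
    then have "cmod (of_real (R\<^sup>2) - cnj a * z) = R * cmod (z - a)"
      by (simp only: norm_mult complex_mod_cnj z)
    then have "cmod (h z) = cmod (f z)"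
      using \<open>0 < R\<close> by (simp add: h_def fg norm_mult norm_divide)
    then show "cmod (h z) \<le> B" using insert.prems(3)[OF z] by simp
  qed
  then have "cmod (h 0) * (cmod a / R) \<le> B * (\<Prod>a\<in>Z. cmod a / R) * (cmod a / R)"
    using \<open>0 < R\<close> by (intro mult_right_mono) auto
  moreover have "cmod (f 0) = cmod (h 0) * (cmod a / R)"
    using \<open>0 < R\<close> by (simp add: h_def fg norm_mult norm_divide norm_power power2_eq_square)
  ultimately show ?case using insert.hyps by (simp add: mult_ac)
qed

text \<open>The logarithm of \<open>R / norm a\<close> is the integral of \<open>1 / t\<close> from \<open>norm a\<close> to \<open>R\<close>. Summing over \<open>Z\<close> gives the
  integral of the counting function divided by \<open>t\<close>, which the hypothesis bounds below. Starting the
  integrals at \<open>T\<close> only decreases them.\<close>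

lemma prod_norm_le_exp:
  fixes Z :: "'a::real_normed_vector set"
  assumes "finite Z" "Z \<subseteq> cball 0 R" "0 < T" "T \<le> R"
    and count: "\<And>t. T \<le> t \<Longrightarrow> t \<le> R \<Longrightarrow> \<beta> * t\<^sup>2 \<le> real (card (Z \<inter> cball 0 t))"
  shows "(\<Prod>a\<in>Z. norm a / R) \<le> exp (- \<beta> * (R\<^sup>2 - T\<^sup>2) / 2)"
proof (cases "0 \<in> Z")
  case True
  then have "(\<Prod>a\<in>Z. norm a / R) = 0" using assms(1) by auto
  then show ?thesis by simp
next
  case False
  \<comment> \<open>points closer to the origin than \<open>T\<close> are treated as if they lay on the sphere of radius \<open>T\<close>\<close>
  define m where "m a = max (norm a) T" for a :: 'a
  have m: "0 < m a" "T \<le> m a" for a using \<open>0 < T\<close> by (auto simp: m_def)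
  have mR: "m a \<le> R" if "a \<in> Z" for a using that assms by (auto simp: m_def)
  define \<phi> where "\<phi> a t = (if t \<in> {m a..R} then 1 / t else 0)" for a and t :: real
  have ln_int: "(\<phi> a has_integral (ln R - ln (m a))) {T..R}" if "a \<in> Z" for a
  proof -
    have "((\<lambda>t. 1 / t) has_integral (ln R - ln (m a))) {m a..R}"
    proof (rule fundamental_theorem_of_calculus[OF mR[OF that]])
      fix t assume "t \<in> {m a..R}"
      then have "0 < t" using m(1)[of a] by simp
      then show "(ln has_vector_derivative 1 / t) (at t within {m a..R})"
        by (auto intro!: derivative_eq_intros simp: has_real_derivative_iff_has_vector_derivative[symmetric])
    qed
    then show ?thesis
      unfolding \<phi>_def[abs_def] using m(2) by (subst has_integral_restrict) auto
  qed
  have 1: "((\<lambda>t. \<Sum>a\<in>Z. \<phi> a t) has_integral (\<Sum>a\<in>Z. ln R - ln (m a))) {T..R}"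
    using assms(1) ln_int by (intro has_integral_sum) auto
  have 2: "((\<lambda>t. \<beta> * t) has_integral (\<beta> * R\<^sup>2 / 2 - \<beta> * T\<^sup>2 / 2)) {T..R}"
    by (rule fundamental_theorem_of_calculus[OF \<open>T \<le> R\<close>])
       (auto intro!: derivative_eq_intros simp: has_real_derivative_iff_has_vector_derivative[symmetric])
  have "\<beta> * R\<^sup>2 / 2 - \<beta> * T\<^sup>2 / 2 \<le> (\<Sum>a\<in>Z. ln R - ln (m a))"
  proof (rule has_integral_le[OF 2 1])
    fix t assume t: "t \<in> {T..R}"
    have t0: "0 < t" using t \<open>0 < T\<close> by simp
    have "(\<Sum>a\<in>Z. \<phi> a t) = (\<Sum>a\<in>Z. if a \<in> cball 0 t then 1 / t else 0)"
      using t by (intro sum.cong) (auto simp: \<phi>_def m_def)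
    also have "\<dots> = real (card (Z \<inter> cball 0 t)) / t"
      using assms(1) by (simp only: sum.If_cases Collect_mem_eq) simp
    finally have "(\<Sum>a\<in>Z. \<phi> a t) = real (card (Z \<inter> cball 0 t)) / t" .
    moreover have "\<beta> * t * t \<le> real (card (Z \<inter> cball 0 t))"
      using count[of t] t by (simp add: power2_eq_square mult.assoc)
    ultimately show "\<beta> * t \<le> (\<Sum>a\<in>Z. \<phi> a t)" using t0 by (simp add: pos_le_divide_eq)
  qed
  also have "\<dots> \<le> (\<Sum>a\<in>Z. - ln (norm a / R))"
  proof (rule sum_mono)
    fix a assume a: "a \<in> Z"
    then have a0: "0 < norm a" using False by auto
    then have "ln (norm a) \<le> ln (m a)" by (intro ln_mono) (auto simp: m_def)
    then show "ln R - ln (m a) \<le> - ln (norm a / R)"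
      using a0 assms by (simp add: ln_div)
  qed
  finally have le: "(\<Sum>a\<in>Z. ln (norm a / R)) \<le> - \<beta> * (R\<^sup>2 - T\<^sup>2) / 2"
    by (simp add: sum_negf algebra_simps diff_divide_distrib)
  have "(\<Prod>a\<in>Z. norm a / R) = (\<Prod>a\<in>Z. exp (ln (norm a / R)))"
    using False \<open>0 < T\<close> \<open>T \<le> R\<close> by (intro prod.cong refl exp_ln[symmetric] divide_pos_pos) auto
  also have "\<dots> = exp (\<Sum>a\<in>Z. ln (norm a / R))" using assms(1) by (simp add: exp_sum)
  finally show ?thesis using le by simp
qed

definition lagrange :: "complex set \<Rightarrow> (complex \<Rightarrow> complex) \<Rightarrow> complex \<Rightarrow> complex" where
  "lagrange Z f z = (\<Sum>a\<in>Z. f a * (\<Prod>b\<in>Z - {a}. (z - b) / (a - b)))"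

lemma holomorphic_lagrange: "lagrange Z f holomorphic_on S"
proof -
  have "(\<lambda>z. (z - b) / (a - b)) holomorphic_on S" for a b :: complex
    by (cases "a = b") (auto intro!: holomorphic_intros)
  then show ?thesis
    unfolding lagrange_def[abs_def] by (auto intro!: holomorphic_intros)
qed

lemma lagrange_eq:
  assumes "finite Z" "c \<in> Z"
  shows "lagrange Z f c = f c"
proof -
  have "(\<Prod>b\<in>Z - {a}. (c - b) / (a - b)) = (if a = c then 1 else 0)" if "a \<in> Z" for a
  proof (cases "a = c")
    case True
    then show ?thesis by (auto intro!: prod.neutral split: if_splits)
  next
    case False
    then have "c \<in> Z - {a}" using assms by auto
    then show ?thesis using False assms(1) by (auto intro!: prod_zero)
  qed
  then have "lagrange Z f c = (\<Sum>a\<in>Z. if a = c then f a else 0)"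
    unfolding lagrange_def by (intro sum.cong) auto
  then show ?thesis using assms by simp
qed

lemma lagrange_bound:
  assumes "finite Z" "Z \<subseteq> cball 0 R" "0 < e" "\<And>a b. a \<in> Z \<Longrightarrow> b \<in> Z \<Longrightarrow> dist a b < e \<Longrightarrow> a = b"
    and s0: "0 \<le> s" and f: "\<And>a. a \<in> Z \<Longrightarrow> cmod (f a) \<le> s" and z: "cmod z \<le> R" and m: "card Z \<le> m"
  shows "cmod (lagrange Z f z) \<le> real m * max 1 (2 * R / e) ^ m * s"
proof -
  define D where "D = max 1 (2 * R / e)"
  have D1: "1 \<le> D" by (simp add: D_def)
  have R0: "0 \<le> R" using z norm_ge_zero order_trans by blast
  have summand: "cmod (f a * (\<Prod>b\<in>Z - {a}. (z - b) / (a - b))) \<le> s * D ^ m" if a: "a \<in> Z" for a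
  proof -
    have "cmod (\<Prod>b\<in>Z - {a}. (z - b) / (a - b)) = (\<Prod>b\<in>Z - {a}. cmod ((z - b) / (a - b)))"
      by (simp add: prod_norm)
    also have "\<dots> \<le> (\<Prod>b\<in>Z - {a}. D)"
    proof (rule prod_mono, intro conjI)
      fix b assume b: "b \<in> Z - {a}"
      then have "e \<le> cmod (a - b)" using assms(4)[OF a, of b] by (force simp: dist_norm)
      moreover have "cmod (z - b) \<le> 2 * R"
        using norm_triangle_ineq4[of z b] z b assms(2) by (force simp: subset_iff)
      ultimately have "cmod ((z - b) / (a - b)) \<le> 2 * R / e"
        unfolding norm_divide using \<open>0 < e\<close> R0 by (intro frac_le) auto
      then show "cmod ((z - b) / (a - b)) \<le> D" by (simp add: D_def)
    qed simp
    also have "\<dots> = D ^ card (Z - {a})" by simp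
    also have "\<dots> \<le> D ^ m"
      using m D1 card_mono[of Z "Z - {a}"] assms(1) by (intro power_increasing) auto
    finally show ?thesis
      unfolding norm_mult using f[OF a] s0 by (intro mult_mono) auto
  qed
  have "cmod (lagrange Z f z) \<le> (\<Sum>a\<in>Z. s * D ^ m)"
    unfolding lagrange_def by (intro order_trans[OF norm_sum] sum_mono summand)
  also have "\<dots> \<le> real m * (s * D ^ m)"
    using m s0 D1 by (simp add: mult_right_mono)
  finally show ?thesis by (simp add: D_def mult_ac)
qed

text \<open>In a disc of radius \<open>R\<close> the translated function \<open>h\<close> differs from its interpolation polynomial \<open>L\<close> at the
  points of the set by a function vanishing at all of them. Jensen's inequality bounds this
  difference at the origin, apart from the contribution of \<open>L\<close>, by \<open>exp (\<alpha> * R\<^sup>2 / 2)\<close>, the growth allowed in the space, times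
  \<open>exp (- \<beta> * (R\<^sup>2 - T\<^sup>2) / 2)\<close>, the effect of the zeros. As \<open>\<alpha> < \<beta>\<close>, a fixed large \<open>R\<close> makes this product
  at most one half. With \<open>R\<close> fixed, separation bounds the number of nodes and hence \<open>L\<close> by a constant times
  the size of \<open>h\<close> on the set.\<close>

lemma sampling_of_card_cball:
  assumes "0 < \<alpha>" "\<alpha> < \<beta>" "uniform_discrete \<Gamma>" "0 < T"
    and count: "\<And>w t. T \<le> t \<Longrightarrow> \<beta> * t\<^sup>2 \<le> real (card (\<Gamma> \<inter> cball w t))"
  obtains K where "0 < K" "samples \<alpha> K \<Gamma>"
proof -
  \<comment> \<open>large enough that \<open>(\<beta> - \<alpha>) * R\<^sup>2 \<ge> \<beta> * T\<^sup>2 + 2\<close>, using \<open>R \<le> R\<^sup>2\<close>\<close>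
  define R where "R = max T (max 1 ((\<beta> * T\<^sup>2 + 2) / (\<beta> - \<alpha>)))"
  have R: "T \<le> R" "1 \<le> R" "0 < R" "(\<beta> * T\<^sup>2 + 2) / (\<beta> - \<alpha>) \<le> R"
    by (auto simp: R_def)
  have small: "exp (\<alpha> * R\<^sup>2 / 2) * exp (- \<beta> * (R\<^sup>2 - T\<^sup>2) / 2) \<le> 1 / 2"
  proof -
    have "\<beta> * T\<^sup>2 + 2 \<le> (\<beta> - \<alpha>) * R" using R(4) assms(2) by (simp add: field_simps)
    also have "\<dots> \<le> (\<beta> - \<alpha>) * R\<^sup>2"
      using R(2) assms(2) by (intro mult_left_mono) (auto simp: power2_eq_square)
    finally have "\<alpha> * R\<^sup>2 / 2 + - \<beta> * (R\<^sup>2 - T\<^sup>2) / 2 \<le> - 1"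
      by (simp add: field_simps)
    then have "exp (\<alpha> * R\<^sup>2 / 2 + - \<beta> * (R\<^sup>2 - T\<^sup>2) / 2) \<le> exp (- 1)"
      by (simp only: exp_le_cancel_iff)
    also have "\<dots> \<le> 1 / (2::real)"
      using exp_ge_add_one_self[of 1] by (simp add: exp_minus field_simps)
    finally show ?thesis by (simp only: exp_add)
  qed
  obtain m where m: "\<And>w. finite (\<Gamma> \<inter> cball w R)" "\<And>w. card (\<Gamma> \<inter> cball w R) \<le> m"
    using uniform_discrete_card_cball_le[OF assms(3)] by blast
  obtain e where e: "e > 0" "\<And>x y. x \<in> \<Gamma> \<Longrightarrow> y \<in> \<Gamma> \<Longrightarrow> dist x y < e \<Longrightarrow> x = y"
    using assms(3) by (auto simp: uniform_discrete_def)
  define E where "E = exp (\<alpha> * R\<^sup>2 / 2)"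
  define A where "A = real m * max 1 (2 * R / e) ^ m * E"
  have A0: "0 \<le> A" by (simp add: A_def E_def)
  have "samples \<alpha> (2 * (2 * A + 1)) \<Gamma>"
  proof (rule samples_by_contraction)
    fix f M s w
    assume f: "f holomorphic_on UNIV" and M: "\<And>z. wmod \<alpha> f z \<le> M"
      and s: "0 \<le> s" "\<And>z. z \<in> \<Gamma> \<Longrightarrow> wmod \<alpha> f z \<le> s"
    have M0: "0 \<le> M" using M[of 0] wmod_nonneg order_trans by blast
    define h where "h = fock_shift \<alpha> w f"
    have h: "h holomorphic_on UNIV" unfolding h_def by (rule holomorphic_fock_shift[OF f])
    have hb: "cmod (h z) \<le> E * x" if "wmod \<alpha> f (z + w) \<le> x" "cmod z \<le> R" "0 \<le> x" for z x
    proof -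
      have "(cmod z)\<^sup>2 \<le> R\<^sup>2" using that by (intro power_mono) auto
      then show ?thesis
        using that \<open>0 < \<alpha>\<close> unfolding E_def
        by (subst cmod_eq_wmod[of _ _ \<alpha>]) (intro mult_mono, auto simp: h_def wmod_fock_shift)
    qed
    define Z where "Z = (\<lambda>z. z - w) ` (\<Gamma> \<inter> cball w R)"
    have Z: "finite Z" "Z \<subseteq> cball 0 R" "\<And>a. a \<in> Z \<Longrightarrow> a + w \<in> \<Gamma>"
      unfolding Z_def using m(1) by (auto simp: dist_norm norm_minus_commute)
    have cardZ: "card (Z \<inter> cball 0 t) = card (\<Gamma> \<inter> cball w t)" if "t \<le> R" for t
    proof -
      have "Z \<inter> cball 0 t = (\<lambda>z. z - w) ` (\<Gamma> \<inter> cball w t)"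
        using that by (force simp: Z_def dist_norm norm_minus_commute)
      then show ?thesis by (simp add: card_image inj_on_def)
    qed
    have "Z \<inter> cball 0 R = Z" using Z(2) by blast
    then have mZ: "card Z \<le> m" using cardZ[of R] m(2)[of w] by simp
    have sep: "a = b" if "a \<in> Z" "b \<in> Z" "dist a b < e" for a b
      using e(2)[of "a + w" "b + w"] Z(3) that by (simp add: dist_norm)
    define L where "L = lagrange Z h"
    have L: "L holomorphic_on UNIV" unfolding L_def by (rule holomorphic_lagrange)
    have hZ: "cmod (h a) \<le> E * s" if "a \<in> Z" for a
      using that Z s by (intro hb) auto
    have Lb: "cmod (L z) \<le> A * s" if "cmod z \<le> R" for z
      using lagrange_bound[OF Z(1,2) e(1) sep _ hZ that mZ] s(1) unfolding L_def A_def by (simp add: mult_ac E_def)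
    define P where "P = (\<Prod>a\<in>Z. cmod a / R)"
    have "P \<le> exp (- \<beta> * (R\<^sup>2 - T\<^sup>2) / 2)"
      unfolding P_def using Z R assms cardZ by (intro prod_norm_le_exp) auto
    then have "E * P \<le> 1 / 2"
      using small unfolding E_def by (meson exp_ge_zero mult_left_mono order_trans)
    have P1: "0 \<le> P" "P \<le> 1"
      unfolding P_def using Z(2) R by (auto intro!: prod_nonneg prod_le_1 simp: subset_iff)
    have "cmod ((\<lambda>z. h z - L z) 0) \<le> (E * M + A * s) * P"
      unfolding P_def
    proof (rule cmod_zero_le_prod_zeros[OF Z(1)])
      show "(\<lambda>z. h z - L z) holomorphic_on UNIV" using h L by (auto intro!: holomorphic_intros)
      show "h a - L a = 0" if "a \<in> Z" for a using lagrange_eq[OF Z(1) that] by (simp add: L_def)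
      show "cmod (h z - L z) \<le> E * M + A * s" if "cmod z = R" for z
        using that M M0 by (intro order_trans[OF norm_triangle_ineq4] add_mono hb Lb) auto
    qed (use R in auto)
    then have "cmod (h 0) \<le> (E * P) * M + A * s * P + A * s"
      using norm_triangle_ineq[of "h 0 - L 0" "L 0"] Lb[of 0] R by (simp add: algebra_simps)
    also have "\<dots> \<le> 1 / 2 * M + A * s * 1 + A * s"
      using \<open>E * P \<le> 1 / 2\<close> M0 P1 A0 s(1) by (intro add_mono mult_right_mono mult_left_mono) auto
    finally have "wmod \<alpha> h 0 \<le> 2 * A * s + M / 2" by simp
    moreover have "wmod \<alpha> h 0 = wmod \<alpha> f w" by (simp only: h_def wmod_fock_shift) simp
    ultimately show "wmod \<alpha> f w \<le> (2 * A + 1) * s + M / 2"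
      using s(1) by (simp add: algebra_simps)
  qed (use A0 in simp)
  then show ?thesis using that[of "2 * (2 * A + 1)"] A0 by simp
qed

section \<open>The density characterisation\<close>

lemma shrunk_square_ge:
  fixes R c \<eta> :: real
  assumes "0 \<le> R" "2 * c \<le> \<eta> * R"
  shows "(1 - \<eta>) * R\<^sup>2 \<le> (R - c)\<^sup>2"
proof -
  have "2 * c * R \<le> \<eta> * R * R" using assms by (intro mult_right_mono) auto
  moreover have "(R - c)\<^sup>2 = R\<^sup>2 - 2 * c * R + c\<^sup>2" by (simp add: power2_diff)
  moreover have "(1 - \<eta>) * R\<^sup>2 = R\<^sup>2 - \<eta> * R * R" by (simp add: power2_eq_square algebra_simps)
  ultimately show ?thesis using zero_le_power2[of c] by linarith
qed

text \<open>The count in discs of radius \<open>R\<close> is at least \<open>\<beta> * (R - c)\<^sup>2\<close>, whose ratio to the area tends to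
  \<open>\<beta> / pi\<close>. The parameter \<open>\<eta>\<close> splits the gap between \<open>\<alpha>\<close> and \<open>\<beta>\<close> among the two losses, one from \<open>c\<close> and
  one from replacing discs by dilates of \<open>I\<close>.\<close>

lemma lower_density_of_samples:
  assumes I: "compact I" "measure lebesgue I = 1" "frontier I \<in> null_sets lebesgue"
    and "0 < \<alpha>" "\<alpha> < \<beta>" "samples \<beta> L \<Gamma>" "0 < L" "uniform_discrete \<Gamma>"
  shows "ereal (\<alpha> / pi) < lower_density I \<Gamma>"
proof -
  have "0 < \<beta>" using assms by simp
  \<comment> \<open>then \<open>exp (- \<beta> * c\<^sup>2 / 2) = exp (- L)\<close>, and \<open>L * exp (- L) < 1\<close>\<close>
  define c where "c = sqrt (2 * L / \<beta>)"
  have c: "0 \<le> c" "- \<beta> * c\<^sup>2 / 2 = - L"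
    using \<open>0 < \<beta>\<close> \<open>0 < L\<close> by (auto simp: c_def)
  have "L < exp L" using exp_ge_add_one_self[of L] by linarith
  then have Lc: "L * exp (- \<beta> * c\<^sup>2 / 2) < 1"
    unfolding c(2) by (simp add: exp_minus field_simps)
  define \<eta> where "\<eta> = (\<beta> - \<alpha>) / (4 * \<beta>)"
  have \<eta>: "0 < \<eta>" "\<eta> < 1" using assms \<open>0 < \<beta>\<close> by (auto simp: \<eta>_def field_simps)
  define R where "R = max (c + 1) (2 * c / \<eta>)"
  have R: "c < R" "2 * c / \<eta> \<le> R" "0 < R" using c(1) by (auto simp: R_def)
  have "2 * c \<le> \<eta> * R" using R(2) \<eta>(1) by (simp add: field_simps)
  then have sq: "(1 - \<eta>) * R\<^sup>2 \<le> (R - c)\<^sup>2" using R(3) by (intro shrunk_square_ge) auto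
  have "\<alpha> < \<beta> * (1 - 2 * \<eta>)"
    using assms \<open>0 < \<beta>\<close> by (simp add: \<eta>_def field_simps)
  also have "\<dots> \<le> \<beta> * ((1 - \<eta>) * (1 - \<eta>))"
    using \<open>0 < \<beta>\<close> by (intro mult_left_mono) (auto simp: algebra_simps)
  also have "\<dots> = \<beta> * ((1 - \<eta>) * R\<^sup>2) / R\<^sup>2 * (1 - \<eta>)" using R(3) by simp
  also have "\<dots> \<le> \<beta> * (R - c)\<^sup>2 / R\<^sup>2 * (1 - \<eta>)"
    using sq \<open>0 < \<beta>\<close> \<eta> by (intro mult_right_mono divide_right_mono mult_left_mono) auto
  finally have "\<alpha> / pi < \<beta> * (R - c)\<^sup>2 / R\<^sup>2 * (1 - \<eta>) / pi" by (intro divide_strict_right_mono) auto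
  also have "\<dots> = \<beta> * (R - c)\<^sup>2 / (pi * R\<^sup>2) * (1 - \<eta>)" by simp
  finally have "ereal (\<alpha> / pi) < ereal (\<beta> * (R - c)\<^sup>2 / (pi * R\<^sup>2) * (1 - \<eta>))" by simp
  also have "\<dots> \<le> lower_density I \<Gamma>"
  proof (rule lower_density_ge_of_card_cball[OF I assms(8) R(3) _ \<eta>(1)])
    show "0 \<le> \<beta> * (R - c)\<^sup>2" using \<open>0 < \<beta>\<close> by simp
    show "\<beta> * (R - c)\<^sup>2 \<le> real (card (\<Gamma> \<inter> cball w R))" for w
      using uniform_discrete_finite_Int_bounded[OF assms(8), of "cball w R"] c R \<open>0 < \<beta>\<close> Lc assms(6)
      by (intro samples_card_cball) auto
  qed
  finally show ?thesis .
qed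

lemma samples_of_lower_density:
  assumes I: "compact I" "measure lebesgue I = 1"
    and "0 < \<alpha>" "uniform_discrete \<Gamma>" "ereal (\<alpha> / pi) < lower_density I \<Gamma>"
  obtains K where "0 < K" "samples \<alpha> K \<Gamma>"
proof -
  obtain \<kappa> where "ereal (\<alpha> / pi) < ereal \<kappa>" and dens: "ereal \<kappa> < lower_density I \<Gamma>"
    using ereal_dense2[OF assms(5)] by blast
  then have \<kappa>: "\<alpha> / pi < \<kappa>" by simp
  obtain c where c: "0 \<le> c" "\<And>w R. c \<le> R \<Longrightarrow> \<kappa> * pi * (R - c)\<^sup>2 \<le> real (card (\<Gamma> \<inter> cball w R))"
    using card_cball_of_lower_density[OF I assms(4) dens] by blast
  define b where "b = \<kappa> * pi"
  have b: "\<alpha> < b" "0 < b" using \<kappa> \<open>0 < \<alpha>\<close> pi_gt_zero by (auto simp: b_def field_simps)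
  \<comment> \<open>half of the gap between \<open>\<alpha>\<close> and \<open>b\<close> pays for the loss of \<open>c\<close> in the radius\<close>
  define \<beta> where "\<beta> = (\<alpha> + b) / 2"
  define \<eta> where "\<eta> = (b - \<alpha>) / (2 * b)"
  have \<eta>: "0 < \<eta>" "b * (1 - \<eta>) = \<beta>" using b by (auto simp: \<eta>_def \<beta>_def field_simps)
  define T where "T = max 1 (max c (2 * c / \<eta>))"
  have T: "0 < T" "c \<le> T" "2 * c / \<eta> \<le> T" by (auto simp: T_def)
  have "\<beta> * t\<^sup>2 \<le> real (card (\<Gamma> \<inter> cball w t))" if t: "T \<le> t" for w t
  proof -
    have "2 * c \<le> \<eta> * t" using order_trans[OF T(3) t] \<eta>(1) by (simp add: field_simps)
    then have "(1 - \<eta>) * t\<^sup>2 \<le> (t - c)\<^sup>2" using T t by (intro shrunk_square_ge) auto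
    then have "b * ((1 - \<eta>) * t\<^sup>2) \<le> b * (t - c)\<^sup>2" using b by (intro mult_left_mono) auto
    then have "\<beta> * t\<^sup>2 \<le> b * (t - c)\<^sup>2" by (simp add: \<eta>(2)[symmetric] mult.assoc)
    also have "\<dots> \<le> real (card (\<Gamma> \<inter> cball w t))"
      unfolding b_def using T t by (intro c(2)) auto
    finally show ?thesis .
  qed
  then show ?thesis
    using sampling_of_card_cball[OF \<open>0 < \<alpha>\<close> _ assms(4) T(1), of \<beta>] b that by (auto simp: \<beta>_def)
qed

theorem theorem1p3:
  fixes \<alpha> :: real and I :: "complex set" and \<Gamma> :: "complex set"
  assumes "\<alpha> > 0"
    and "compact I" and "measure lebesgue I = 1" and "frontier I \<in> null_sets lebesgue"
    and "discrete \<Gamma>"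
  shows "set_of_sampling \<alpha> \<Gamma> \<longleftrightarrow>
    (\<exists>\<Gamma>'\<subseteq>\<Gamma>. uniform_discrete \<Gamma>' \<and> lower_density I \<Gamma>' > ereal (\<alpha> / pi))"
proof
  assume "set_of_sampling \<alpha> \<Gamma>"
  then obtain K where "0 < K" "samples \<alpha> K \<Gamma>" by (auto simp: set_of_sampling_iff)
  then obtain \<Gamma>' where \<Gamma>': "\<Gamma>' \<subseteq> \<Gamma>" "uniform_discrete \<Gamma>'" "samples \<alpha> (2 * K) \<Gamma>'"
    using samples_uniform_discrete_subset[OF assms(1)] by blast
  obtain \<beta> L where "\<alpha> < \<beta>" "0 < L" "samples \<beta> L \<Gamma>'"
    using samples_larger_exponent[OF assms(1) _ \<Gamma>'(3)] \<open>0 < K\<close> by auto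
  then have "ereal (\<alpha> / pi) < lower_density I \<Gamma>'"
    using lower_density_of_samples[OF assms(2,3,4,1)] \<Gamma>'(2) by blast
  then show "\<exists>\<Gamma>'\<subseteq>\<Gamma>. uniform_discrete \<Gamma>' \<and> lower_density I \<Gamma>' > ereal (\<alpha> / pi)"
    using \<Gamma>' by blast
next
  assume "\<exists>\<Gamma>'\<subseteq>\<Gamma>. uniform_discrete \<Gamma>' \<and> lower_density I \<Gamma>' > ereal (\<alpha> / pi)"
  then obtain \<Gamma>' where \<Gamma>': "\<Gamma>' \<subseteq> \<Gamma>" "uniform_discrete \<Gamma>'" "ereal (\<alpha> / pi) < lower_density I \<Gamma>'"
    by blast
  obtain K where "0 < K" "samples \<alpha> K \<Gamma>'"
    using samples_of_lower_density[OF assms(2,3,1) \<Gamma>'(2,3)] by blast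
  then show "set_of_sampling \<alpha> \<Gamma>"
    using samples_mono[OF _ \<Gamma>'(1)] by (auto simp: set_of_sampling_iff)
qed

end
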